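(* The algebra ${}^{\mathrm{Dr}}\widetilde{\mathbf U}^{\imath}$ is generated by $\mathbb K_i^{\pm1}$, $C^{\pm1}$, $\Theta_{i,k}$ and $B_{i,l}$ ($i\in\mathbb I_0$, $k\ge1$, $l\in\mathbb Z$), subject to (as a complete set of defining relations) the following relations, for $i,j\in\mathbb I_0$: (a) $\mathbb K_i$ and $C$ are central (with $\mathbb K_i\mathbb K_i^{-1}=1=CC^{-1}$), and $\boldsymbol\Theta_i(z)\boldsymbol\Theta_j(w)=\boldsymbol\Theta_j(w)\boldsymbol\Theta_i(z)$; (b) $\displaystyle\boldsymbol\Theta_i(z)\mathbf B_j(w)=\frac{(1-v^{-c_{ij}}zw^{-1})(1-v^{c_{ij}}zwC)}{(1-v^{c_{ij}}zw^{-1})(1-v^{-c_{ij}}zwC)}\mathbf B_j(w)\boldsymbol\Theta_i(z)$; (c) $\mathbf B_i(w)\mathbf B_j(z)=\mathbf B_j(z)\mathbf B_i(w)$ if $c_{ij}=0$; (d) $(v^{c_{ij}}z-w)\mathbf B_i(z)\mathbf B_j(w)+(v^{c_{ij}}w-z)\mathbf B_j(w)\mathbf B_i(z)=0$ if $i\ne j$; (e) $\displaystyle(v^2z-w)\mathbf B_i(z)\mathbf B_i(w)+(v^2w-z)\mathbf B_i(w)\mathbf B_i(z)=\frac{v^{-2}}{v-v^{-1}}\mathbb K_i\boldsymbol\Delta(zw)\big((v^2z-w)\boldsymbol\Theta_i(w)+(v^2w-z)\boldsymbol\Theta_i(z)\big)$; (f) if $c_{ij}=-1$: $$\mathbf B_i(w_1)\mathbf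 B_i(w_2)\mathbf B_j(z)-[2]\mathbf B_i(w_1)\mathbf B_j(z)\mathbf B_i(w_2)+\mathbf B_j(z)\mathbf B_i(w_1)\mathbf B_i(w_2)+\{w_1\leftrightarrow w_2\}$$ $$=-\mathbb K_i\frac{\boldsymbol\Delta(w_1w_2)}{v-v^{-1}}\Big([\boldsymbol\Theta_i(w_2),\mathbf B_j(z)]_{v^{-2}}\frac{[2]zw_1^{-1}}{1-v^2w_2w_1^{-1}}+[\mathbf B_j(z),\boldsymbol\Theta_i(w_2)]_{v^{-2}}\frac{1+w_2w_1^{-1}}{1-v^2w_2w_1^{-1}}\Big)+\{w_1\leftrightarrow w_2\}.$$
   Context: $v$ is an indeterminate; algebras are unital associative over $\mathbb Q(v)$. $[n]=\frac{v^n-v^{-n}}{v-v^{-1}}$, $[A,B]_{v^a}=AB-v^aBA$, $[A,B]=AB-BA$. $(c_{ij})_{i,j\in\mathbb I_0}$ is the Cartan matrix of a simple Lie algebra of type ADE. The algebra ${}^{\mathrm{Dr}}\widetilde{\mathbf U}^{\imath}$ is defined to be generated by $\mathbb K_i^{\pm1},C^{\pm1},H_{i,m},B_{i,l}$ ($i\in\mathbb I_0$, $m\ge1$, $l\in\mathbb Z$) subject to, for $m,n\ge1$, $k,l,k_1,k_2\in\mathbb Z$, $i,j\in\mathbb I_0$: (1) $\mathbb K_i,C$ central, $[H_{i,m},H_{j,n}]=0$, $\mathbb K_i\mathbb K_i^{-1}=1$, $CC^{-1}=1$; (2) $[H_{i,m},B_{j,l}]=\frac{[mc_{ij}]}mB_{j,l+m}-\frac{[mc_{ij}]}mB_{j,l-m}C^m$;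 (3) $[B_{i,k},B_{j,l}]=0$ if $c_{ij}=0$; (4) $[B_{i,k},B_{j,l+1}]_{v^{-c_{ij}}}-v^{-c_{ij}}[B_{i,k+1},B_{j,l}]_{v^{c_{ij}}}=0$ if $i\ne j$; (5) $[B_{i,k},B_{i,l+1}]_{v^{-2}}-v^{-2}[B_{i,k+1},B_{i,l}]_{v^2}=v^{-2}\Theta_{i,l-k+1}C^k\mathbb K_i-v^{-4}\Theta_{i,l-k-1}C^{k+1}\mathbb K_i+v^{-2}\Theta_{i,k-l+1}C^l\mathbb K_i-v^{-4}\Theta_{i,k-l-1}C^{l+1}\mathbb K_i$; (6) if $c_{ij}=-1$: $S(k_1,k_2|l)+S(k_2,k_1|l)=R(k_1,k_2|l)+R(k_2,k_1|l)$, where $S(k_1,k_2|l)=B_{i,k_1}B_{i,k_2}B_{j,l}-[2]B_{i,k_1}B_{j,l}B_{i,k_2}+B_{j,l}B_{i,k_1}B_{i,k_2}$ and $$R(k_1,k_2|l)=\mathbb K_iC^{k_1}\Big(-\sum_{p\ge0}v^{2p}[2][\Theta_{i,k_2-k_1-2p-1},B_{j,l-1}]_{v^{-2}}C^{p+1}-\sum_{p\ge1}v^{2p-1}[2][B_{j,l},\Theta_{i,k_2-k_1-2p}]_{v^{-2}}C^p-[B_{j,l},\Theta_{i,k_2-k_1}]_{v^{-2}}\Big).$$ Here $\Theta_{i,0}=(v-v^{-1})^{-1}$, $\Theta_{i,m}=0$ for $m<0$, and for $m\ge1$ the $\Theta_{i,m}$ are defined by $1+\sum_{m\ge1}(v-v^{-1})\Theta_{i,m}u^m=\exp\big((v-v^{-1})\sum_{m\ge1}H_{i,m}u^m\big)$.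 Generating functions: $\mathbf B_i(z)=\sum_{k\in\mathbb Z}B_{i,k}z^k$, $\boldsymbol\Theta_i(z)=1+\sum_{m>0}(v-v^{-1})\Theta_{i,m}z^m$, $\boldsymbol\Delta(z)=\sum_{k\in\mathbb Z}C^kz^k$. The symbol $\{w_1\leftrightarrow w_2\}$ means the preceding expression on the same side with $w_1,w_2$ exchanged. Rational functions are expanded as formal series: in (b) in nonnegative powers of $z$; in (f), $\frac1{1-v^2w_2w_1^{-1}}=\sum_{p\ge0}v^{2p}w_2^pw_1^{-p}$ (and with $w_1,w_2$ exchanged in the exchanged term). *)

theory Defs
  imports
    "HOL-Library.Poly_Mapping"
    "HOL-Library.Product_Plus"
    "HOL-Library.Function_Algebras"
    "HOL-Computational_Algebra.Polynomial"
    "HOL-Computational_Algebra.Fraction_Field"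
    "HOL-Computational_Algebra.Formal_Power_Series"
    "HOL-Algebra.QuotRing"
begin

type_synonym qv = "rat poly fract"

definition v :: qv where
  "v = Fract [:0, 1:] 1"

definition qint :: "int \<Rightarrow> qv" where
  "qint n = (v powi n - v powi (- n)) / (v - inverse v)"

text \<open>The Dynkin diagrams live on the nodes $0, \dots, n-1$; every edge is listed in one direction.
  In types D and E the nodes $0, \dots, n-2$ form a chain, and the node $n-1$ is attached to the
  node $n-3$ (type D) or to the node $2$ (type E).\<close>

definition dynkin_chain :: "nat \<Rightarrow> (nat \<times> nat) set" where
  "dynkin_chain n = {(k, Suc k) | k. Suc k < n}"

definition dynkin_A :: "nat \<Rightarrow> (nat \<times> nat) set" where
  "dynkin_A n = dynkin_chain n"

definition dynkin_D :: "nat \<Rightarrow> (nat \<times> nat) set" where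
  "dynkin_D n = insert (n - 3, n - 1) (dynkin_chain (n - 1))"

definition dynkin_E :: "nat \<Rightarrow> (nat \<times> nat) set" where
  "dynkin_E n = insert (2, n - 1) (dynkin_chain (n - 1))"

definition ADE_diagram :: "nat \<Rightarrow> (nat \<times> nat) set \<Rightarrow> bool" where
  "ADE_diagram n E \<longleftrightarrow>
     n \<ge> 1 \<and> E = dynkin_A n \<or> n \<ge> 4 \<and> E = dynkin_D n \<or> n \<in> {6, 7, 8} \<and> E = dynkin_E n"

definition ADE_cartan :: "('i \<Rightarrow> 'i \<Rightarrow> int) \<Rightarrow> bool" where
  "ADE_cartan c \<longleftrightarrow>
     (\<exists>n E. \<exists>\<nu> :: 'i \<Rightarrow> nat. ADE_diagram n E \<and> bij_betw \<nu> UNIV {..<n} \<and>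
        (\<forall>i j. c i j =
          (if i = j then 2 else if (\<nu> i, \<nu> j) \<in> E \<or> (\<nu> j, \<nu> i) \<in> E then - 1 else 0)))"

text \<open>Words under concatenation, written additively so that the convolution product of
  \<^theory>\<open>HOL-Library.Poly_Mapping\<close> makes finitely supported functions on words the free algebra.\<close>

datatype 'g fword = FWord "'g list"

instantiation fword :: (type) monoid_add
begin

definition zero_fword :: "'a fword" where
  "zero_fword = FWord []"

fun plus_fword :: "'a fword \<Rightarrow> 'a fword \<Rightarrow> 'a fword" where
  "plus_fword (FWord xs) (FWord ys) = FWord (xs @ ys)"

instance
proof
  fix a b c :: "'a fword"
  show "a + b + c = a + (b + c)" by (cases a; cases b; cases c) simp
  show "0 + a = a" by (cases a) (simp add: zero_fword_def)
  show "a + 0 = a" by (cases a) (simp add: zero_fword_def)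
qed

end

type_synonym 'g free = "'g fword \<Rightarrow>\<^sub>0 qv"

definition scal :: "qv \<Rightarrow> 'g free" where
  "scal a = Poly_Mapping.single 0 a"

definition gen :: "'g \<Rightarrow> 'g free" where
  "gen g = Poly_Mapping.single (FWord [g]) 1"

definition free_alg :: "'g free ring" where
  "free_alg = \<lparr>carrier = UNIV, mult = (*), one = 1, zero = 0, add = (+)\<rparr>"

lemma ring_free_alg: "ring (free_alg :: 'g free ring)"
proof (rule ringI)
  show "abelian_group (free_alg :: 'g free ring)"
  proof (rule abelian_groupI)
    fix x :: "'g free"
    show "\<exists>y\<in>carrier free_alg. y \<oplus>\<^bsub>free_alg\<^esub> x = \<zero>\<^bsub>free_alg\<^esub>"
      by (rule bexI[of _ "- x"]) (simp_all add: free_alg_def)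
  qed (simp_all add: free_alg_def algebra_simps)
  show "Group.monoid (free_alg :: 'g free ring)"
    by (rule monoidI) (simp_all add: free_alg_def algebra_simps)
qed (simp_all add: free_alg_def algebra_simps)

text \<open>The algebra with generators \<^typ>\<open>'g\<close> and relations $r = 0$ for $r \in R$.
  Its $\mathbb{Q}(v)$-algebra structure is given by \<open>\<lambda>a. cls R (scal a)\<close>.\<close>

definition presented :: "'g free set \<Rightarrow> 'g free set ring" where
  "presented R = free_alg Quot (Idl\<^bsub>free_alg\<^esub> R)"

definition cls :: "'g free set \<Rightarrow> 'g free \<Rightarrow> 'g free set" where
  "cls R x = (Idl\<^bsub>free_alg\<^esub> R) +>\<^bsub>free_alg\<^esub> x"

definition qcomm :: "qv \<Rightarrow> 'g free \<Rightarrow> 'g free \<Rightarrow> 'g free" where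
  "qcomm a x y = x * y - scal a * y * x"

text \<open>\<open>DrHSuc i m\<close> stands for $H_{i,m+1}$, since $H_{i,m}$ is a generator only for $m \ge 1$.\<close>

datatype 'i dr_gen = DrK 'i | DrKinv 'i | DrC | DrCinv | DrHSuc 'i nat | DrB 'i int

abbreviation dK :: "'i \<Rightarrow> 'i dr_gen free" where "dK i \<equiv> gen (DrK i)"
abbreviation dKinv :: "'i \<Rightarrow> 'i dr_gen free" where "dKinv i \<equiv> gen (DrKinv i)"
abbreviation dC :: "'i dr_gen free" where "dC \<equiv> gen DrC"
abbreviation dCinv :: "'i dr_gen free" where "dCinv \<equiv> gen DrCinv"
abbreviation dB :: "'i \<Rightarrow> int \<Rightarrow> 'i dr_gen free" where "dB i l \<equiv> gen (DrB i l)"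

text \<open>Meaningful for $m \ge 1$ only.\<close>
definition dH :: "'i \<Rightarrow> nat \<Rightarrow> 'i dr_gen free" where
  "dH i m = gen (DrHSuc i (m - 1))"

definition dCpow :: "int \<Rightarrow> 'i dr_gen free" where
  "dCpow k = (if k \<ge> 0 then dC ^ nat k else dCinv ^ nat (- k))"

text \<open>The series $\exp\big((v - v^{-1}) \sum_{m \ge 1} H_{i,m} u^m\big)$ with coefficients in the free
  algebra; \<open>fps_exp\<close> itself requires coefficients in a field.\<close>

definition dTheta_exp :: "'i \<Rightarrow> 'i dr_gen free fps" where
  "dTheta_exp i = Abs_fps (\<lambda>n. scal (inverse (fact n))) oo
     Abs_fps (\<lambda>m. if m = 0 then 0 else scal (v - inverse v) * dH i m)"

definition dTheta :: "'i \<Rightarrow> int \<Rightarrow> 'i dr_gen free" where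
  "dTheta i m =
    (if m < 0 then 0
     else if m = 0 then scal (inverse (v - inverse v))
     else scal (inverse (v - inverse v)) * fps_nth (dTheta_exp i) (nat m))"

definition dr_rel1 :: "'i dr_gen free set" where
  "dr_rel1 =
     {dK i * gen g - gen g * dK i | i g. True} \<union>
     {dC * gen g - gen g * dC | g. True} \<union>
     {dH i m * dH j n - dH j n * dH i m | i j m n. m \<ge> 1 \<and> n \<ge> 1} \<union>
     {dK i * dKinv i - 1 | i. True} \<union>
     {dC * dCinv - 1}"

definition dr_rel2 :: "('i \<Rightarrow> 'i \<Rightarrow> int) \<Rightarrow> 'i dr_gen free set" where
  "dr_rel2 c =
     {(dH i m * dB j l - dB j l * dH i m) -
      (scal (qint (int m * c i j) / of_nat m) * dB j (l + int m)
       - scal (qint (int m * c i j) / of_nat m) * dB j (l - int m) * dC ^ m)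
      | i j m l. m \<ge> 1}"

definition dr_rel3 :: "('i \<Rightarrow> 'i \<Rightarrow> int) \<Rightarrow> 'i dr_gen free set" where
  "dr_rel3 c = {dB i k * dB j l - dB j l * dB i k | i j k l. c i j = 0}"

definition dr_rel4 :: "('i \<Rightarrow> 'i \<Rightarrow> int) \<Rightarrow> 'i dr_gen free set" where
  "dr_rel4 c =
     {qcomm (v powi (- c i j)) (dB i k) (dB j (l + 1))
      - scal (v powi (- c i j)) * qcomm (v powi (c i j)) (dB i (k + 1)) (dB j l)
      | i j k l. i \<noteq> j}"

definition dr_rel5 :: "'i dr_gen free set" where
  "dr_rel5 =
     {(qcomm (v powi (- 2)) (dB i k) (dB i (l + 1))
       - scal (v powi (- 2)) * qcomm (v powi 2) (dB i (k + 1)) (dB i l)) -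
      (scal (v powi (- 2)) * dTheta i (l - k + 1) * dCpow k * dK i
       - scal (v powi (- 4)) * dTheta i (l - k - 1) * dCpow (k + 1) * dK i
       + scal (v powi (- 2)) * dTheta i (k - l + 1) * dCpow l * dK i
       - scal (v powi (- 4)) * dTheta i (k - l - 1) * dCpow (l + 1) * dK i)
      | i k l. True}"

definition dS :: "'i \<Rightarrow> 'i \<Rightarrow> int \<Rightarrow> int \<Rightarrow> int \<Rightarrow> 'i dr_gen free" where
  "dS i j k1 k2 l =
     dB i k1 * dB i k2 * dB j l
     - scal (qint 2) * dB i k1 * dB j l * dB i k2
     + dB j l * dB i k1 * dB i k2"

text \<open>Only finitely many summands are nonzero, since \<open>dTheta\<close> vanishes at negative indices.\<close>

definition dR :: "'i \<Rightarrow> 'i \<Rightarrow> int \<Rightarrow> int \<Rightarrow> int \<Rightarrow> 'i dr_gen free" where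
  "dR i j k1 k2 l =
     dK i * dCpow k1 *
     (- Sum_any (\<lambda>p::nat. scal (v ^ (2 * p) * qint 2)
           * qcomm (v powi (- 2)) (dTheta i (k2 - k1 - 2 * int p - 1)) (dB j (l - 1)) * dC ^ (p + 1))
      - Sum_any (\<lambda>p::nat. if p \<ge> 1 then scal (v ^ (2 * p - 1) * qint 2)
           * qcomm (v powi (- 2)) (dB j l) (dTheta i (k2 - k1 - 2 * int p)) * dC ^ p else 0)
      - qcomm (v powi (- 2)) (dB j l) (dTheta i (k2 - k1)))"

definition dr_rel6 :: "('i \<Rightarrow> 'i \<Rightarrow> int) \<Rightarrow> 'i dr_gen free set" where
  "dr_rel6 c =
     {(dS i j k1 k2 l + dS i j k2 k1 l) - (dR i j k1 k2 l + dR i j k2 k1 l)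
      | i j k1 k2 l. c i j = - 1}"

definition dr_rels :: "('i \<Rightarrow> 'i \<Rightarrow> int) \<Rightarrow> 'i dr_gen free set" where
  "dr_rels c = dr_rel1 \<union> dr_rel2 c \<union> dr_rel3 c \<union> dr_rel4 c \<union> dr_rel5 \<union> dr_rel6 c"

text \<open>Formal distributions in three commuting variables: functions from exponent vectors to
  coefficients, added pointwise. A monomial $x^u$ is given by its exponent vector $u$, so the product
  $zw$ of variables is \<open>z + w\<close> and the quotient $zw^{-1}$ is \<open>z - w\<close>. The product
  is written \<open>\<star>\<close> (the operation \<open>*\<close> on functions is pointwise and is not used);
  it is meaningful when every coefficient is a finite sum.\<close>

type_synonym expo = "int \<times> int \<times> int"

type_synonym 'a fdist = "expo \<Rightarrow> 'a"

abbreviation x1 :: expo where "x1 \<equiv> (1, 0, 0)"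
abbreviation x2 :: expo where "x2 \<equiv> (0, 1, 0)"
abbreviation x3 :: expo where "x3 \<equiv> (0, 0, 1)"

fun expo_mult :: "int \<Rightarrow> expo \<Rightarrow> expo" where
  "expo_mult k (a, b, c) = (k * a, k * b, k * c)"

definition fd_mult :: "'a::ring_1 fdist \<Rightarrow> 'a fdist \<Rightarrow> 'a fdist" (infixl \<open>\<star>\<close> 70) where
  "(f \<star> g) e = Sum_any (\<lambda>d. f d * g (e - d))"

definition mon :: "'a::ring_1 \<Rightarrow> expo \<Rightarrow> 'a fdist" where
  "mon a u e = (if e = u then a else 0)"

text \<open>The distribution $\sum_{k \in \mathbb{Z}} a_k x^{ku}$, for $u \ne 0$.\<close>
definition bilat :: "(int \<Rightarrow> 'a::ring_1) \<Rightarrow> expo \<Rightarrow> 'a fdist" where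
  "bilat a u e = (\<Sum>k | expo_mult k u = e. a k)"

text \<open>The expansion $\sum_{p \ge 0} a^p x^{pu}$ of $(1 - a x^u)^{-1}$.\<close>
definition geom :: "'a::ring_1 \<Rightarrow> expo \<Rightarrow> 'a fdist" where
  "geom a u = bilat (\<lambda>k. if k \<ge> 0 then a ^ nat k else 0) u"

definition fd_qcomm :: "qv \<Rightarrow> 'g free fdist \<Rightarrow> 'g free fdist \<Rightarrow> 'g free fdist" where
  "fd_qcomm a f g = f \<star> g - mon (scal a) 0 \<star> g \<star> f"

text \<open>\<open>GfThetaSuc i m\<close> stands for $\Theta_{i,m+1}$.\<close>

datatype 'i gf_gen = GfK 'i | GfKinv 'i | GfC | GfCinv | GfThetaSuc 'i nat | GfB 'i int

abbreviation gK :: "'i \<Rightarrow> 'i gf_gen free" where "gK i \<equiv> gen (GfK i)"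
abbreviation gKinv :: "'i \<Rightarrow> 'i gf_gen free" where "gKinv i \<equiv> gen (GfKinv i)"
abbreviation gC :: "'i gf_gen free" where "gC \<equiv> gen GfC"
abbreviation gCinv :: "'i gf_gen free" where "gCinv \<equiv> gen GfCinv"
abbreviation gB :: "'i \<Rightarrow> int \<Rightarrow> 'i gf_gen free" where "gB i l \<equiv> gen (GfB i l)"

text \<open>Meaningful for $k \ge 1$ only.\<close>
definition gTheta :: "'i \<Rightarrow> nat \<Rightarrow> 'i gf_gen free" where
  "gTheta i k = gen (GfThetaSuc i (k - 1))"

definition gCpow :: "int \<Rightarrow> 'i gf_gen free" where
  "gCpow k = (if k \<ge> 0 then gC ^ nat k else gCinv ^ nat (- k))"

definition BB :: "'i \<Rightarrow> expo \<Rightarrow> 'i gf_gen free fdist" where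
  "BB i z = bilat (gB i) z"

definition Th :: "'i \<Rightarrow> expo \<Rightarrow> 'i gf_gen free fdist" where
  "Th i z = mon 1 0 + bilat (\<lambda>m. if m > 0 then scal (v - inverse v) * gTheta i (nat m) else 0) z"

definition Delta :: "expo \<Rightarrow> 'i gf_gen free fdist" where
  "Delta z = bilat gCpow z"

text \<open>In each of the following relations the arguments \<open>z\<close>, \<open>w\<close>, \<open>w1\<close>, \<open>w2\<close> are variables
  (distinct unit exponent vectors).\<close>

definition rel_a :: "'i \<Rightarrow> 'i \<Rightarrow> expo \<Rightarrow> expo \<Rightarrow> 'i gf_gen free fdist" where
  "rel_a i j z w = Th i z \<star> Th j w - Th j w \<star> Th i z"

definition rel_b :: "('i \<Rightarrow> 'i \<Rightarrow> int) \<Rightarrow> 'i \<Rightarrow> 'i \<Rightarrow> expo \<Rightarrow> expo \<Rightarrow> 'i gf_gen free fdist" where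
  "rel_b c i j z w =
     Th i z \<star> BB j w -
     (mon 1 0 - mon (scal (v powi (- c i j))) (z - w))
     \<star> (mon 1 0 - mon (scal (v powi (c i j)) * gC) (z + w))
     \<star> geom (scal (v powi (c i j))) (z - w)
     \<star> geom (scal (v powi (- c i j)) * gC) (z + w)
     \<star> BB j w \<star> Th i z"

definition rel_c :: "'i \<Rightarrow> 'i \<Rightarrow> expo \<Rightarrow> expo \<Rightarrow> 'i gf_gen free fdist" where
  "rel_c i j z w = BB i w \<star> BB j z - BB j z \<star> BB i w"

definition rel_d :: "('i \<Rightarrow> 'i \<Rightarrow> int) \<Rightarrow> 'i \<Rightarrow> 'i \<Rightarrow> expo \<Rightarrow> expo \<Rightarrow> 'i gf_gen free fdist" where
  "rel_d c i j z w =
     (mon (scal (v powi (c i j))) z - mon 1 w) \<star> BB i z \<star> BB j w +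
     (mon (scal (v powi (c i j))) w - mon 1 z) \<star> BB j w \<star> BB i z"

definition rel_e :: "'i \<Rightarrow> expo \<Rightarrow> expo \<Rightarrow> 'i gf_gen free fdist" where
  "rel_e i z w =
     ((mon (scal (v ^ 2)) z - mon 1 w) \<star> BB i z \<star> BB i w +
      (mon (scal (v ^ 2)) w - mon 1 z) \<star> BB i w \<star> BB i z) -
     mon (scal (v powi (- 2) / (v - inverse v)) * gK i) 0 \<star> Delta (z + w)
     \<star> ((mon (scal (v ^ 2)) z - mon 1 w) \<star> Th i w +
        (mon (scal (v ^ 2)) w - mon 1 z) \<star> Th i z)"

definition lhs_f :: "'i \<Rightarrow> 'i \<Rightarrow> expo \<Rightarrow> expo \<Rightarrow> expo \<Rightarrow> 'i gf_gen free fdist" where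
  "lhs_f i j w1 w2 z =
     BB i w1 \<star> BB i w2 \<star> BB j z
     - mon (scal (qint 2)) 0 \<star> BB i w1 \<star> BB j z \<star> BB i w2
     + BB j z \<star> BB i w1 \<star> BB i w2"

definition rhs_f :: "'i \<Rightarrow> 'i \<Rightarrow> expo \<Rightarrow> expo \<Rightarrow> expo \<Rightarrow> 'i gf_gen free fdist" where
  "rhs_f i j w1 w2 z =
     - (mon (gK i * scal (inverse (v - inverse v))) 0 \<star> Delta (w1 + w2)
        \<star> (fd_qcomm (v powi (- 2)) (Th i w2) (BB j z)
             \<star> mon (scal (qint 2)) (z - w1) \<star> geom (scal (v ^ 2)) (w2 - w1)
           + fd_qcomm (v powi (- 2)) (BB j z) (Th i w2)
             \<star> (mon 1 0 + mon 1 (w2 - w1)) \<star> geom (scal (v ^ 2)) (w2 - w1)))"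

definition rel_f :: "'i \<Rightarrow> 'i \<Rightarrow> expo \<Rightarrow> expo \<Rightarrow> expo \<Rightarrow> 'i gf_gen free fdist" where
  "rel_f i j w1 w2 z =
     (lhs_f i j w1 w2 z + lhs_f i j w2 w1 z) - (rhs_f i j w1 w2 z + rhs_f i j w2 w1 z)"

text \<open>An identity of formal distributions imposes the vanishing of all its coefficients.\<close>

definition gf_rels :: "('i \<Rightarrow> 'i \<Rightarrow> int) \<Rightarrow> 'i gf_gen free set" where
  "gf_rels c =
     {gK i * gen g - gen g * gK i | i g. True} \<union>
     {gC * gen g - gen g * gC | g. True} \<union>
     {gK i * gKinv i - 1 | i. True} \<union>
     {gC * gCinv - 1} \<union>
     {rel_a i j x1 x2 e | i j e. True} \<union>
     {rel_b c i j x1 x2 e | i j e. True} \<union>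
     {rel_c i j x1 x2 e | i j e. c i j = 0} \<union>
     {rel_d c i j x1 x2 e | i j e. i \<noteq> j} \<union>
     {rel_e i x1 x2 e | i e. True} \<union>
     {rel_f i j x1 x2 x3 e | i j e. c i j = - 1}"

end

theory Submission
  imports Defs
begin

text \<open>The two presentations have all generators in common except that one uses $H_{i,m}$ and the
  other $\Theta_{i,m}$. Write $X_m = (v - v^{-1}) H_{i,m}$, and let $T_n$ be the coefficients of
  $\exp(\sum_m X_m u^m)$, so that $T_0 = 1$ and $T_n = (v - v^{-1}) \Theta_{i,n}$ for $n \ge 1$. When
  the $X_m$ commute, taking the logarithmic derivative of the exponential gives Newton's recursion
  $n T_n = \sum_{m=1}^n m X_m T_{n-m}$ (\<open>newton_exp\<close>). Over $\mathbb{Q}(v)$ it can be solved for the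
  $T_n$ as well as for the $X_n$, each as a noncommutative polynomial in the others. It therefore
  replaces both exponential and logarithm: it defines the substitution \<open>to_gf\<close> inverse to
  \<open>to_dr\<close>, it shows that the $X_m$ commute with each other exactly when the $T_n$ do, and its
  solutions are unique. It remains to see that the two substitutions respect the relations.

  Among the other relations, the only one for which this needs an idea is the one between $\Theta_i$ and $\mathbf{B}_j$
  (\<open>current_commutation\<close>). The factor by which $\boldsymbol\Theta_i(z)$ and $\mathbf{B}_j(w)$ commute
  is a product of two Moebius functions, in $z w^{-1}$ and $z w C$; its logarithmic derivative in
  $z$ is the generating function of the coefficients in $[H_{i,m}, \mathbf{B}_j(w)]$. Comparing
  coefficients of $z^n$, the failure of the $\Theta$-relation in degree $n$ equals, up to the
  invertible factor $n$, the failure of the $H$-relation in degree $n$, as soon as both relations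
  hold in lower degrees. So the two families are equivalent by induction on $n$.

  The relations among the $\mathbf{B}_i$ match coefficient by coefficient: the coefficient of $z^{k+1} w^{l+1}$ in the
  quadratic relations is a power of $v$ times the relation with indices $k, l$, and in the Serre
  relation the geometric series is collapsed by the delta function $\boldsymbol\Delta(w_1 w_2)$ into the
  two finite sums of $R(k_1, k_2 | l)$, where $(1 + x)/(1 - v^2 x) = 1 + \sum_{p \ge 1} v^{2p-1} [2] x^p$.

  Both directions are consequences of one equivalence, \<open>relations_iff\<close>: for homomorphisms from the two
  free algebras into one ring that agree on corresponding generators, with $K_i$ and $C$ central and
  Newton's recursion between $H$ and $\Theta$, the first kills its relations if and only if the second
  does. It is applied with each of the two quotients as the ring.\<close>

section \<open>Free algebras\<close>

lemma scal_add: "scal (a + b) = scal a + scal b"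
  by (simp add: scal_def Poly_Mapping.single_add)
lemma scal_diff: "scal (a - b) = scal a - scal b"
  by (simp add: scal_def single_diff)
lemma scal_mult: "scal (a * b) = scal a * scal b"
  by (simp add: scal_def mult_single)
lemma scal_0 [simp]: "scal 0 = 0"
  by (simp add: scal_def)
lemma scal_1 [simp]: "scal 1 = 1"
  by (simp add: scal_def)
lemma scal_power: "scal (a ^ n) = scal a ^ n"
  by (induction n) (simp_all add: scal_mult)

text \<open>Scalars sit at the empty word, which is the neutral element for concatenation; so they act
  on coefficients and are central.\<close>

lemma lookup_scal_mult: "Poly_Mapping.lookup (scal a * p) w = a * Poly_Mapping.lookup p w"
proof -
  have "Poly_Mapping.lookup (scal a * p) w = (\<Sum>k. (a when 0 = k) * (\<Sum>q. Poly_Mapping.lookup p q when w = k + q))"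
    by (simp add: scal_def lookup_mult lookup_single)
  also have "\<dots> = (\<Sum>k. (a * (\<Sum>q. Poly_Mapping.lookup p q when w = k + q)) when k = 0)"
    by (rule Sum_any.cong) (simp add: when_def)
  also have "\<dots> = a * Poly_Mapping.lookup p w"
    by (simp only: Sum_any_when_equal) (simp add: Sum_any_when_equal')
  finally show ?thesis .
qed

lemma scal_central: "scal a * p = p * scal a"
proof -
  have "Poly_Mapping.lookup (p * scal a) w = a * Poly_Mapping.lookup p w" for w
  proof -
    have "Poly_Mapping.lookup (p * scal a) w = (\<Sum>k. Poly_Mapping.lookup p k * (\<Sum>q. (a when 0 = q) when w = k + q))"
      by (simp add: scal_def lookup_mult lookup_single)
    also have "\<dots> = (\<Sum>k. Poly_Mapping.lookup p k * (\<Sum>q. (a when w = k + q) when q = 0))"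
      by (intro Sum_any.cong arg_cong2[where f = "(*)"] refl) (simp add: when_def)
    also have "\<dots> = (\<Sum>k. (Poly_Mapping.lookup p k * a) when w = k)"
      by (intro Sum_any.cong) (simp add: when_def)
    also have "\<dots> = a * Poly_Mapping.lookup p w"
      by (simp add: Sum_any_when_equal')
    finally show ?thesis .
  qed
  then show ?thesis
    by (intro poly_mapping_eqI) (simp add: lookup_scal_mult)
qed

lemma scal_left_commute: "p * (scal a * q) = scal a * (p * q)"
  by (metis mult.assoc scal_central)

fun eval_word :: "('g \<Rightarrow> 'h free) \<Rightarrow> 'g fword \<Rightarrow> 'h free" where
  "eval_word \<sigma> (FWord xs) = prod_list (map \<sigma> xs)"

text \<open>The algebra homomorphism with given values on the generators.\<close>

definition subst :: "('g \<Rightarrow> 'h free) \<Rightarrow> 'g free \<Rightarrow> 'h free" where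
  "subst \<sigma> p = Sum_any (\<lambda>w. scal (Poly_Mapping.lookup p w) * eval_word \<sigma> w)"

lemma eval_word_add: "eval_word \<sigma> (u + w) = eval_word \<sigma> u * eval_word \<sigma> w"
  by (cases u; cases w) simp

lemma eval_word_0 [simp]: "eval_word \<sigma> 0 = 1"
  by (simp add: zero_fword_def)

lemma finite_lookup_term: "finite {w. scal (Poly_Mapping.lookup p w) * f w \<noteq> (0 :: 'h free)}"
  by (rule finite_subset[OF _ finite_lookup[of p]]) auto

lemma subst_add: "subst \<sigma> (p + q) = subst \<sigma> p + subst \<sigma> q"
  unfolding subst_def lookup_add scal_add distrib_right
  by (rule Sum_any.distrib) (rule finite_lookup_term)+

lemma subst_single: "subst \<sigma> (Poly_Mapping.single w a) = scal a * eval_word \<sigma> w"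
proof -
  have "subst \<sigma> (Poly_Mapping.single w a) = Sum_any (\<lambda>u. if u = w then scal a * eval_word \<sigma> u else 0)"
    unfolding subst_def by (rule Sum_any.cong) (auto simp: lookup_single when_def)
  then show ?thesis by simp
qed

text \<open>Elements of the free algebra are sums of scalar multiples of words.\<close>

lemma free_induct [case_names single add]:
  fixes p :: "'g free"
  assumes "\<And>w a. P (Poly_Mapping.single w a)" "\<And>p q. P p \<Longrightarrow> P q \<Longrightarrow> P (p + q)"
  shows "P p"
proof -
  have "P (\<Sum>w\<in>A. Poly_Mapping.single w (Poly_Mapping.lookup p w))" if "finite A" for A
    using that
  proof (induction A)
    case empty
    show ?case using assms(1)[of 0 0] by simp
  qed (use assms in simp)
  moreover have "p = (\<Sum>w\<in>Poly_Mapping.keys p. Poly_Mapping.single w (Poly_Mapping.lookup p w))"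
    by (intro poly_mapping_eqI)
       (auto simp: lookup_sum lookup_single when_def in_keys_iff sum.delta)
  ultimately show ?thesis by (metis finite_keys)
qed

lemma subst_mult: "subst \<sigma> (p * q) = subst \<sigma> p * subst \<sigma> q"
proof (induction p rule: free_induct)
  case (single u a)
  show ?case
  proof (induction q rule: free_induct)
    case (single w b)
    have "scal (a * b) * (eval_word \<sigma> u * eval_word \<sigma> w) =
        scal a * eval_word \<sigma> u * (scal b * eval_word \<sigma> w)"
      by (simp only: scal_mult mult.assoc scal_left_commute[of "eval_word \<sigma> u" b])
    then show ?case
      by (simp add: mult_single subst_single eval_word_add)
  qed (simp add: subst_add algebra_simps)
qed (simp add: subst_add algebra_simps)

lemma subst_scal: "subst \<sigma> (scal a) = scal a"
  using subst_single[of \<sigma> 0 a] by (simp add: scal_def)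

lemma subst_gen [simp]: "subst \<sigma> (gen g) = \<sigma> g"
  by (simp add: gen_def subst_single)

lemma single_eq_gens:
  "Poly_Mapping.single (FWord xs) a = scal a * prod_list (map gen xs)"
proof -
  have "prod_list (map gen xs) = Poly_Mapping.single (FWord xs) 1"
    by (induction xs) (simp_all add: gen_def mult_single flip: zero_fword_def)
  then show ?thesis by (simp add: scal_def mult_single flip: zero_fword_def)
qed

lemma free_alg_induct [case_names scal gen add mult]:
  fixes p :: "'g free"
  assumes "\<And>a. P (scal a)" "\<And>g. P (gen g)" "\<And>p q. P p \<Longrightarrow> P q \<Longrightarrow> P (p + q)"
    "\<And>p q. P p \<Longrightarrow> P q \<Longrightarrow> P (p * q)"
  shows "P p"
proof (induction p rule: free_induct)
  case (single w a)
  obtain xs where w: "w = FWord xs" by (cases w)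
  have "P (prod_list (map gen xs))"
    by (induction xs) (use assms(1)[of 1] assms(2,4) in auto)
  then show ?case unfolding w single_eq_gens using assms(1,4) by blast
qed (use assms in blast)

section \<open>Quotients of a free algebra\<close>

interpretation FA: ring "free_alg :: 'g free ring" by (rule ring_free_alg)

abbreviation rideal :: "'g free set \<Rightarrow> 'g free set" where
  "rideal R \<equiv> Idl\<^bsub>free_alg\<^esub> R"

lemma free_alg_simps [simp]:
  "carrier free_alg = UNIV" "x \<otimes>\<^bsub>free_alg\<^esub> y = x * y" "x \<oplus>\<^bsub>free_alg\<^esub> y = x + y"
  "\<one>\<^bsub>free_alg\<^esub> = 1" "\<zero>\<^bsub>free_alg\<^esub> = 0"
  by (simp_all add: free_alg_def)

lemma free_alg_minus [simp]: "\<ominus>\<^bsub>free_alg\<^esub> x = - (x :: 'g free)"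
  using FA.r_neg[of x] by simp (metis add.inverse_unique)

lemma ideal_rideal: "ideal (rideal R) (free_alg :: 'g free ring)"
  by (rule FA.genideal_ideal) simp

lemma rideal_rel: "r \<in> R \<Longrightarrow> r \<in> rideal R"
  using FA.genideal_self[of R] by auto

lemma rideal_0: "0 \<in> rideal R"
  using additive_subgroup.zero_closed[OF ideal.axioms(1)[OF ideal_rideal]] by simp

lemma rideal_add: "x \<in> rideal R \<Longrightarrow> y \<in> rideal R \<Longrightarrow> x + y \<in> rideal R"
  using additive_subgroup.a_closed[OF ideal.axioms(1)[OF ideal_rideal]] by fastforce

lemma rideal_mult: "x \<in> rideal R \<Longrightarrow> y * x \<in> rideal R" "x \<in> rideal R \<Longrightarrow> x * y \<in> rideal R"
  using ideal.I_l_closed[OF ideal_rideal, of x R y] ideal.I_r_closed[OF ideal_rideal, of x R y]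
  by auto

lemma rideal_uminus: "x \<in> rideal R \<Longrightarrow> - x \<in> rideal R"
  using rideal_mult(1)[of x R "- 1"] by simp

lemma rideal_diff: "x \<in> rideal R \<Longrightarrow> y \<in> rideal R \<Longrightarrow> x - y \<in> rideal R"
  using rideal_add[OF _ rideal_uminus] by fastforce

text \<open>A type cannot depend on a set of relations, so the quotients by all sets of relations are
  packed into one product ring. Each quotient sits in it as a factor, through the map \<open>quo\<close>, which is
  additive and multiplicative but does not preserve the unit. In this way congruences modulo relations
  become equations in a type of class \<^class>\<open>ring\<close>.\<close>

quotient_type 'g quots = "'g free set \<Rightarrow> 'g free" / "\<lambda>f g. \<forall>R. f R - g R \<in> rideal R"
proof (intro equivpI reflpI sympI transpI allI)
  fix f g h :: "'g free set \<Rightarrow> 'g free" and R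
  show "f R - f R \<in> rideal R" by (simp add: rideal_0)
  assume *: "\<forall>R. f R - g R \<in> rideal R"
  show "g R - f R \<in> rideal R" using rideal_uminus[OF *[rule_format, of R]] by simp
  assume "\<forall>R. g R - h R \<in> rideal R"
  with * show "f R - h R \<in> rideal R" using rideal_add[of "f R - g R" R "g R - h R"] by simp
qed

instantiation quots :: (type) ring
begin

lift_definition zero_quots :: "'a quots" is "\<lambda>_. 0" .

lift_definition plus_quots :: "'a quots \<Rightarrow> 'a quots \<Rightarrow> 'a quots" is "\<lambda>f g R. f R + g R"
  using rideal_add by (fastforce simp: algebra_simps)

lift_definition uminus_quots :: "'a quots \<Rightarrow> 'a quots" is "\<lambda>f R. - f R"
  using rideal_uminus by fastforce

lift_definition minus_quots :: "'a quots \<Rightarrow> 'a quots \<Rightarrow> 'a quots" is "\<lambda>f g R. f R - g R"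
  using rideal_diff by (fastforce simp: algebra_simps)

lift_definition times_quots :: "'a quots \<Rightarrow> 'a quots \<Rightarrow> 'a quots" is "\<lambda>f g R. f R * g R"
proof -
  fix f f' g g' :: "'a free set \<Rightarrow> 'a free" and R
  assume "\<And>R. f R - f' R \<in> rideal R" "\<And>R. g R - g' R \<in> rideal R"
  then have "(f R - f' R) * g R + f' R * (g R - g' R) \<in> rideal R"
    by (intro rideal_add rideal_mult)
  then show "f R * g R - f' R * g' R \<in> rideal R" by (simp add: algebra_simps)
qed

instance
  by standard (transfer; simp add: algebra_simps rideal_0)+

end

definition quo :: "'g free set \<Rightarrow> 'g free \<Rightarrow> 'g quots" where
  "quo R x = abs_quots (\<lambda>S. if S = R then x else 0)"

lemma quo_add: "quo R (x + y) = quo R x + quo R y"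
  unfolding quo_def plus_quots.abs_eq by (rule arg_cong[where f = abs_quots]) (rule ext, simp)

lemma quo_mult: "quo R (x * y) = quo R x * quo R y"
  unfolding quo_def times_quots.abs_eq by (rule arg_cong[where f = abs_quots]) (rule ext, simp)

lemma quo_eq_0_iff: "quo R x = 0 \<longleftrightarrow> x \<in> rideal R"
  unfolding quo_def zero_quots_def quots.abs_eq_iff by (simp add: rideal_0)

section \<open>Newton's recursion\<close>

locale scalars =
  fixes s :: "qv \<Rightarrow> 'b::ring"
  assumes s_add: "s (a + b) = s a + s b"
    and s_mult: "s (a * b) = s a * s b"
begin

text \<open>The homomorphisms considered later do not preserve the unit, so that \<open>s 1\<close> is only an
  idempotent. On \<open>U\<close>, which contains their images, it acts as the unit and scalars are central.\<close>

definition U :: "'b set" where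
  "U = {y. s 1 * y = y \<and> (\<forall>a. s a * y = y * s a)}"

lemma s_0 [simp]: "s 0 = 0"
  using s_add[of 0 0] by simp

lemma s_minus: "s (- a) = - s a"
  using s_add[of a "- a"] by (simp add: eq_neg_iff_add_eq_0 add.commute)

lemma s_sum: "s (sum a I) = (\<Sum>i\<in>I. s (a i))"
  by (induction I rule: infinite_finite_induct) (simp_all add: s_add)

lemma U_one: "y \<in> U \<Longrightarrow> s 1 * y = y" "y \<in> U \<Longrightarrow> y * s 1 = y"
  by (auto simp: U_def)

lemma U_comm: "y \<in> U \<Longrightarrow> y * s a = s a * y"
  by (auto simp: U_def)

lemma U_left_comm: "y \<in> U \<Longrightarrow> y * (s a * z) = s a * (y * z)"
  by (metis U_comm mult.assoc)

lemma U_s [simp, intro]: "s a \<in> U"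
  by (simp add: U_def mult.commute flip: s_mult)

lemma U_add [intro]: "x \<in> U \<Longrightarrow> y \<in> U \<Longrightarrow> x + y \<in> U"
  unfolding U_def mem_Collect_eq by (metis distrib_left distrib_right)

lemma U_diff [intro]: "x \<in> U \<Longrightarrow> y \<in> U \<Longrightarrow> x - y \<in> U"
  unfolding U_def mem_Collect_eq by (metis left_diff_distrib right_diff_distrib)

lemma U_0 [simp, intro]: "0 \<in> U"
  by (simp add: U_def)

lemma U_mult [intro]: "x \<in> U \<Longrightarrow> y \<in> U \<Longrightarrow> x * y \<in> U"
  by (simp add: U_def) (metis mult.assoc)

lemma U_sum [intro]: "(\<And>i. i \<in> I \<Longrightarrow> h i \<in> U) \<Longrightarrow> sum h I \<in> U"
  by (induction I rule: infinite_finite_induct) auto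

lemma s_cancel:
  assumes "a \<noteq> 0" "x \<in> U" "y \<in> U"
  shows "s a * x = s a * y \<longleftrightarrow> x = y"
proof
  assume "s a * x = s a * y"
  then have "s (inverse a) * (s a * x) = s (inverse a) * (s a * y)" by simp
  then show "x = y" using assms by (simp add: U_one flip: mult.assoc s_mult)
qed simp

text \<open>For commuting $x_m$ this is the equation $T' = X' T$ that $T = \exp X$ satisfies for
  $X(u) = \sum_m x_m u^m$, written in coefficients. It is the same recursion as Newton's identities between power
  sums and complete symmetric functions, with $m x_m$ as the $m$-th power sum.\<close>

definition newton :: "(nat \<Rightarrow> 'b) \<Rightarrow> (nat \<Rightarrow> 'b) \<Rightarrow> bool" where
  "newton x t \<longleftrightarrow> (\<forall>n. s (of_nat n) * t n = (\<Sum>m = 1..n. s (of_nat m) * (x m * t (n - m))))"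

text \<open>The recursion determines $t_n$ from lower terms since $n$ is invertible. Its summand for
  $m = n$ is $n x_n$, which gives the same for $x_n$.\<close>

lemma newton_unique_right:
  assumes "newton x t" "newton x t'" "t 0 = t' 0" "\<And>n. t n \<in> U" "\<And>n. t' n \<in> U"
  shows "t n = t' n"
proof (induction n rule: less_induct)
  case (less n)
  show ?case
  proof (cases "n = 0")
    case False
    have "s (of_nat n) * t n = s (of_nat n) * t' n"
      using assms(1,2) False less.IH by (simp add: newton_def)
    then show ?thesis using False s_cancel[OF _ assms(4,5), of "of_nat n" n n] by simp
  qed (use assms in simp)
qed

lemma newton_last:
  assumes "newton x t" "n \<ge> 1" "t 0 = s 1" "x n \<in> U"
  shows "s (of_nat n) * t n =
    (\<Sum>m = 1..<n. s (of_nat m) * (x m * t (n - m))) + s (of_nat n) * x n"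
proof -
  have "{1..n} = insert n {1..<n}" using assms(2) by auto
  then show ?thesis using assms by (simp add: newton_def U_one add.commute)
qed

lemma newton_unique_left:
  assumes "newton x t" "newton x' t" "t 0 = s 1" "n \<ge> 1"
    "\<And>n. n \<ge> 1 \<Longrightarrow> x n \<in> U" "\<And>n. n \<ge> 1 \<Longrightarrow> x' n \<in> U"
  shows "x n = x' n"
  using assms(4)
proof (induction n rule: less_induct)
  case (less n)
  have "s (of_nat n) * x n = s (of_nat n) * x' n"
    using newton_last[OF assms(1) less.prems assms(3) assms(5)]
      newton_last[OF assms(2) less.prems assms(3) assms(6)] less by simp
  then show ?case using less.prems s_cancel[OF _ assms(5,6), of "of_nat n" n n] by simp
qed

text \<open>Each $t_n$ is a polynomial in $x_1, \dots, x_n$ and conversely; so whatever commutes with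
  one of the sequences commutes with the other.\<close>

lemma newton_commute_right:
  assumes nt: "newton x t" and t0: "t 0 = s 1" and tU: "\<And>n. t n \<in> U" and zU: "z \<in> U"
    and zx: "\<And>n. n \<ge> 1 \<Longrightarrow> z * x n = x n * z"
  shows "z * t n = t n * z"
proof (induction n rule: less_induct)
  case (less n)
  show ?case
  proof (cases "n = 0")
    case False
    have "s (of_nat n) * (z * t n) = z * (\<Sum>m = 1..n. s (of_nat m) * (x m * t (n - m)))"
      using nt unfolding newton_def by (metis U_left_comm[OF zU])
    also have "\<dots> = (\<Sum>m = 1..n. s (of_nat m) * (x m * t (n - m))) * z"
      unfolding sum_distrib_left sum_distrib_right
    proof (rule sum.cong[OF refl])
      fix m assume "m \<in> {1..n}"
      then have "z * (x m * t (n - m)) = x m * t (n - m) * z"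
        using zx[of m] less.IH[of "n - m"] by (metis atLeastAtMost_iff diff_less le_trans less_eq_Suc_le One_nat_def mult.assoc)
      then show "z * (s (of_nat m) * (x m * t (n - m))) = s (of_nat m) * (x m * t (n - m)) * z"
        by (simp add: U_left_comm[OF zU] mult.assoc)
    qed
    also have "\<dots> = s (of_nat n) * (t n * z)"
      using nt by (simp add: newton_def mult.assoc[symmetric])
    finally show ?thesis
      using False s_cancel[of "of_nat n" "z * t n" "t n * z"] zU tU by (simp add: U_mult)
  qed (simp add: t0 U_comm[OF zU])
qed

lemma newton_commute_left:
  assumes nt: "newton x t" and t0: "t 0 = s 1" and xU: "\<And>n. n \<ge> 1 \<Longrightarrow> x n \<in> U"
    and tU: "\<And>n. t n \<in> U" and zU: "z \<in> U" and zt: "\<And>n. z * t n = t n * z"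
  shows "n \<ge> 1 \<Longrightarrow> z * x n = x n * z"
proof (induction n rule: less_induct)
  case (less n)
  let ?S = "\<Sum>m = 1..<n. s (of_nat m) * (x m * t (n - m))"
  have last: "s (of_nat n) * x n = s (of_nat n) * t n - ?S"
    using newton_last[OF nt less.prems t0 xU] less.prems by simp
  have "z * ?S = ?S * z"
    unfolding sum_distrib_left sum_distrib_right
  proof (rule sum.cong[OF refl])
    fix m assume "m \<in> {1..<n}"
    then have "z * (x m * t (n - m)) = x m * t (n - m) * z"
      using less.IH[of m] zt by (metis atLeastLessThan_iff mult.assoc)
    then show "z * (s (of_nat m) * (x m * t (n - m))) = s (of_nat m) * (x m * t (n - m)) * z"
      by (simp add: U_left_comm[OF zU] mult.assoc)
  qed
  then have "z * (s (of_nat n) * x n) = (s (of_nat n) * x n) * z"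
    unfolding last right_diff_distrib left_diff_distrib
    by (simp add: U_left_comm[OF zU] zt mult.assoc)
  then have "s (of_nat n) * (z * x n) = s (of_nat n) * (x n * z)"
    by (simp add: U_left_comm[OF zU] mult.assoc)
  then show ?case
    using less.prems s_cancel[of "of_nat n" "z * x n" "x n * z"] zU xU[OF less.prems] by (simp add: U_mult)
qed

end

locale free_hom =
  fixes f :: "'g free \<Rightarrow> 'b::ring"
  assumes f_add: "f (p + q) = f p + f q"
    and f_mult: "f (p * q) = f p * f q"
begin

definition s :: "qv \<Rightarrow> 'b" where "s a = f (scal a)"

lemma f_scal: "f (scal a) = s a"
  by (simp add: s_def)

lemma f_1: "f 1 = s 1"
  by (simp add: s_def)

sublocale scalars s
  by unfold_locales (simp_all add: s_def scal_add scal_mult f_add f_mult)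

lemma f_0 [simp]: "f 0 = 0"
  using f_add[of 0 0] by simp

lemma f_minus: "f (- p) = - f p"
  using f_add[of p "- p"] by (simp add: eq_neg_iff_add_eq_0 add.commute)

lemma f_diff: "f (p - q) = f p - f q"
  using f_add[of p "- q"] by (simp add: f_minus)

lemma f_sum: "f (sum h I) = (\<Sum>i\<in>I. f (h i))"
  by (induction I rule: infinite_finite_induct) (simp_all add: f_add)

lemma f_U [simp, intro]: "f p \<in> U"
  by (simp add: U_def s_def scal_central flip: f_mult)

text \<open>Well-definedness on the quotient: the kernel is an ideal.\<close>

lemma vanishes_on_rideal:
  assumes "\<And>r. r \<in> R \<Longrightarrow> f r = 0" "x \<in> rideal R"
  shows "f x = 0"
proof -
  have "ideal {x. f x = 0} (free_alg :: 'g free ring)"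
  proof (intro idealI ring_free_alg subgroup.intro)
    fix x assume "x \<in> {x. f x = 0}"
    then show "inv\<^bsub>add_monoid free_alg\<^esub> x \<in> {x. f x = 0}"
      using free_alg_minus[of x] by (simp add: a_inv_def f_minus)
  qed (auto simp: f_add f_mult)
  then show ?thesis using FA.genideal_minimal[of _ R] assms by blast
qed

lemma commute_all:
  assumes "\<And>g. f p * f (gen g) = f (gen g) * f p"
  shows "f p * f q = f q * f p"
proof (induction q rule: free_alg_induct)
  case (mult q r)
  then show ?case by (simp add: f_mult) (metis mult.assoc)
qed (use assms in \<open>simp_all add: f_scal U_comm f_add algebra_simps\<close>)

end

lemma scal_of_nat: "scal (of_nat n) = of_nat n"
  by (induction n) (simp_all add: scal_add)

context free_hom
begin

text \<open>The target need not have a unit, so powers and \<open>fps_compose\<close> are only formed upstairs, in the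
  free algebra; commutativity is available only downstairs.\<close>

definition fps_image :: "'g free fps \<Rightarrow> 'b fps" where
  "fps_image a = Abs_fps (\<lambda>n. f (fps_nth a n))"

lemma fps_image_add: "fps_image (a + b) = fps_image a + fps_image b"
  by (simp add: fps_image_def fps_eq_iff f_add)

lemma fps_image_mult: "fps_image (a * b) = fps_image a * fps_image b"
  by (simp add: fps_image_def fps_eq_iff f_mult f_sum fps_mult_nth)

text \<open>In the image, $X$ commutes with $X'$, so that $(X^{k+1})' = (k+1) X' X^k$.\<close>

lemma fps_image_deriv_power:
  assumes "fps_image X * fps_image (fps_deriv X) = fps_image (fps_deriv X) * fps_image X"
  shows "fps_image (fps_deriv (X ^ Suc k)) = fps_image (of_nat (Suc k) * (fps_deriv X * X ^ k))"
proof (induction k)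
  case (Suc k)
  have "fps_deriv (X ^ Suc (Suc k)) = X * fps_deriv (X ^ Suc k) + fps_deriv X * X ^ Suc k"
    by (simp only: power_Suc[of X "Suc k"] fps_deriv_mult)
  then have "fps_image (fps_deriv (X ^ Suc (Suc k))) =
      fps_image X * fps_image (of_nat (Suc k) * (fps_deriv X * X ^ k))
      + fps_image (fps_deriv X * X ^ Suc k)"
    by (simp only: fps_image_add fps_image_mult Suc.IH)
  also have "fps_image X * fps_image (of_nat (Suc k) * (fps_deriv X * X ^ k)) =
      fps_image (of_nat (Suc k) * (fps_deriv X * X ^ Suc k))"
  proof -
    have "X * (of_nat (Suc k) * (fps_deriv X * X ^ k)) = of_nat (Suc k) * ((X * fps_deriv X) * X ^ k)"
      by (simp only: mult.assoc[symmetric] mult_of_nat_commute[of "Suc k" X])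
    then have "fps_image X * fps_image (of_nat (Suc k) * (fps_deriv X * X ^ k)) =
        fps_image (of_nat (Suc k)) * ((fps_image X * fps_image (fps_deriv X)) * fps_image (X ^ k))"
      by (simp only: fps_image_mult[symmetric])
    also have "\<dots> = fps_image (of_nat (Suc k)) * ((fps_image (fps_deriv X) * fps_image X) * fps_image (X ^ k))"
      by (simp only: assms)
    finally show ?thesis by (simp only: fps_image_mult[symmetric] power_Suc mult.assoc)
  qed
  also have "\<dots> + fps_image (fps_deriv X * X ^ Suc k) =
      fps_image (of_nat (Suc (Suc k)) * (fps_deriv X * X ^ Suc k))"
    by (simp only: fps_image_add[symmetric]) (simp add: algebra_simps)
  finally show ?case .
qed simp

lemma power_low_coeff:
  assumes "fps_nth (X :: 'a::ring_1 fps) 0 = 0" "n < k"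
  shows "fps_nth (X ^ k) n = 0"
  using assms(2)
proof (induction k arbitrary: n)
  case (Suc k)
  have "fps_nth X i * fps_nth (X ^ k) (n - i) = 0" if "i \<le> n" for i
    using Suc assms(1) that by (cases "i = 0") auto
  then show ?case by (simp add: fps_mult_nth)
qed simp

text \<open>Differentiate the exponential series termwise: $(X^{k+1}/(k+1)!)' = X' X^k / k!$, hence
  $E' = X' E$.\<close>

lemma newton_exp:
  fixes X :: "'g free fps"
  assumes X0: "fps_nth X 0 = 0"
    and comm: "\<And>m n. f (fps_nth X m) * f (fps_nth X n) = f (fps_nth X n) * f (fps_nth X m)"
  defines "E \<equiv> Abs_fps (\<lambda>n. scal (inverse (fact n))) oo X"
  shows "newton (\<lambda>n. f (fps_nth X n)) (\<lambda>n. f (fps_nth E n))"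
proof -
  have E: "fps_nth E n = (\<Sum>k\<le>N. scal (inverse (fact k)) * fps_nth (X ^ k) n)" if "n \<le> N" for n N
    unfolding E_def fps_compose_nth
    by (rule sum.mono_neutral_cong_left) (use that power_low_coeff[OF X0] in auto)
  have "fps_image X * fps_image (fps_deriv X) = fps_image (fps_deriv X) * fps_image X"
  proof -
    have "f (fps_nth X i) * f (fps_nth (fps_deriv X) j) = f (fps_nth (fps_deriv X) j) * f (fps_nth X i)" for i j
    proof -
      have "f (fps_nth X i) * (f (scal (of_nat (j + 1))) * f (fps_nth X (j + 1))) =
         f (scal (of_nat (j + 1))) * f (fps_nth X (j + 1)) * f (fps_nth X i)"
        by (simp only: U_left_comm[OF f_U, unfolded s_def] comm[of i] mult.assoc)
      then show ?thesis by (simp only: fps_deriv_nth f_mult scal_of_nat[symmetric])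
    qed
    then have "(\<Sum>i=0..n. f (fps_nth X i) * f (fps_nth (fps_deriv X) (n - i))) =
        (\<Sum>i=0..n. f (fps_nth (fps_deriv X) i) * f (fps_nth X (n - i)))" for n
      by (intro sum.reindex_bij_witness[of _ "\<lambda>i. n - i" "\<lambda>i. n - i"]) (auto simp del: fps_deriv_nth)
    then show ?thesis
      by (simp add: fps_eq_iff fps_image_def fps_mult_nth del: fps_deriv_nth)
  qed
  note DP = fps_image_deriv_power[OF this]
  have "f (scal (of_nat n)) * f (fps_nth E n) =
      (\<Sum>m = 1..n. f (scal (of_nat m)) * (f (fps_nth X m) * f (fps_nth E (n - m))))" for n
  proof (cases n)
    case (Suc n')
    have step: "f (scal (inverse (fact (Suc k))) * fps_nth (fps_deriv (X ^ Suc k)) n') =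
        f (scal (inverse (fact k)) * fps_nth (fps_deriv X * X ^ k) n')" for k
    proof -
      have "f (fps_nth (fps_deriv (X ^ Suc k)) n') = f (fps_nth (of_nat (Suc k) * (fps_deriv X * X ^ k)) n')"
        using arg_cong[OF DP[of k], of "\<lambda>a. fps_nth a n'"] by (simp add: fps_image_def del: power_Suc)
      also have "\<dots> = f (scal (of_nat (Suc k)) * fps_nth (fps_deriv X * X ^ k) n')"
        by (simp only: scal_of_nat fps_of_nat[symmetric] fps_mult_left_const_nth)
      finally have "f (scal (inverse (fact (Suc k))) * fps_nth (fps_deriv (X ^ Suc k)) n') =
          f (scal (inverse (fact (Suc k)) * of_nat (Suc k)) * fps_nth (fps_deriv X * X ^ k) n')"
        by (simp only: f_mult scal_mult mult.assoc)
      moreover have "inverse (fact (Suc k)) * of_nat (Suc k) = (inverse (fact k) :: qv)"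
        by (simp add: field_simps del: of_nat_Suc)
      ultimately show ?thesis by (simp only:)
    qed
    have "f (scal (of_nat n)) * f (fps_nth E n) =
        f (\<Sum>k\<le>Suc n'. scal (inverse (fact k)) * fps_nth (fps_deriv (X ^ k)) n')"
    proof -
      have "scal (of_nat n) * fps_nth E n = (\<Sum>k\<le>Suc n'. scal (inverse (fact k)) * (scal (of_nat n) * fps_nth (X ^ k) n))"
        unfolding E[of n "Suc n'", OF eq_refl[OF Suc]] sum_distrib_left
        by (simp only: mult.assoc[symmetric] scal_central[of _ "scal (inverse (fact _))"])
      then show ?thesis
        by (simp only: f_mult[symmetric] Suc scal_of_nat fps_deriv_nth) simp
    qed
    also have "\<dots> = f (\<Sum>k\<le>n'. scal (inverse (fact k)) * fps_nth (fps_deriv X * X ^ k) n')"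
      by (subst sum.atMost_Suc_shift) (simp only: f_sum f_add step power_0 fps_deriv_1, simp)
    also have "(\<Sum>k\<le>n'. scal (inverse (fact k)) * fps_nth (fps_deriv X * X ^ k) n') =
        (\<Sum>k\<le>n'. \<Sum>i\<le>n'. fps_nth (fps_deriv X) i * (scal (inverse (fact k)) * fps_nth (X ^ k) (n' - i)))"
      by (simp only: fps_mult_nth sum_distrib_left atLeast0AtMost mult.assoc[symmetric]
           scal_central[of _ "fps_nth (fps_deriv X) _"])
    also have "\<dots> = (\<Sum>i\<le>n'. fps_nth (fps_deriv X) i * fps_nth E (n' - i))"
      by (subst sum.swap) (simp add: E[of "n' - _" n'] sum_distrib_left del: fps_deriv_nth)
    also have "f \<dots> = (\<Sum>i\<le>n'. f (scal (of_nat (Suc i))) * (f (fps_nth X (Suc i)) * f (fps_nth E (n - Suc i))))"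
      by (simp add: f_sum f_mult Suc mult.assoc flip: scal_of_nat)
    also have "\<dots> = (\<Sum>m = 1..n. f (scal (of_nat m)) * (f (fps_nth X m) * f (fps_nth E (n - m))))"
      by (rule sum.reindex_bij_witness[of _ "\<lambda>m. m - 1" Suc]) (auto simp: Suc)
    finally show ?thesis .
  qed simp
  then show ?thesis by (simp add: newton_def s_def)
qed

end

section \<open>Commuting $\Theta$ past a current\<close>

text \<open>The coefficients of $(1 - a x)/(1 - b x)$.\<close>

definition mobius :: "'a::comm_ring_1 \<Rightarrow> 'a \<Rightarrow> nat \<Rightarrow> 'a" where
  "mobius a b p = (if p = 0 then 1 else b ^ p - a * b ^ (p - 1))"

text \<open>The logarithmic derivative of $(1 - a x)/(1 - b x)$ is
  $\sum_{m \ge 1} (b^m - a^m) x^{m-1}$.\<close>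

lemma mobius_recursion:
  fixes a b :: "'a::comm_ring_1"
  shows "of_nat n * mobius a b n = (\<Sum>m = 1..n. (b ^ m - a ^ m) * mobius a b (n - m))"
proof (cases n)
  case (Suc k)
  have S: "(\<Sum>m = 1..k. (b ^ m - a ^ m) * b ^ (k - m)) * (b - a) =
      of_nat k * (b - a) * b ^ k - (b ^ k - a ^ k) * a" for k
  proof (induction k)
    case (Suc k)
    have "(\<Sum>m = 1..Suc k. (b ^ m - a ^ m) * b ^ (Suc k - m)) =
        (\<Sum>m = 1..k. b * ((b ^ m - a ^ m) * b ^ (k - m))) + (b ^ Suc k - a ^ Suc k)"
      by (simp add: Suc_diff_le mult.left_commute)
    then have "(\<Sum>m = 1..Suc k. (b ^ m - a ^ m) * b ^ (Suc k - m)) * (b - a) =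
        b * ((\<Sum>m = 1..k. (b ^ m - a ^ m) * b ^ (k - m)) * (b - a)) + (b ^ Suc k - a ^ Suc k) * (b - a)"
      by (simp only: sum_distrib_left[symmetric] distrib_right mult.assoc)
    then show ?case unfolding Suc.IH by (simp add: algebra_simps)
  qed simp
  have "(\<Sum>m = 1..n. (b ^ m - a ^ m) * mobius a b (n - m)) =
      (\<Sum>m = 1..k. (b ^ m - a ^ m) * mobius a b (n - m)) + (b ^ n - a ^ n)"
    by (simp add: Suc mobius_def)
  also have "(\<Sum>m = 1..k. (b ^ m - a ^ m) * mobius a b (n - m)) =
      (\<Sum>m = 1..k. (b ^ m - a ^ m) * b ^ (k - m)) * (b - a)"
    unfolding sum_distrib_right
    by (rule sum.cong) (auto simp: Suc mobius_def Suc_diff_le algebra_simps)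
  finally show ?thesis unfolding S by (simp add: Suc mobius_def algebra_simps)
qed simp

text \<open>Both are substitutions in sums over $m + p + q = k$ with $m \ge 1$.\<close>

lemma sum_triangle:
  "(\<Sum>p\<le>k. \<Sum>m = 1..p. F m (p - m) (k - p)) = (\<Sum>m = 1..k. \<Sum>p\<le>k - m. F m p (k - m - p))"
  for F :: "nat \<Rightarrow> nat \<Rightarrow> nat \<Rightarrow> 'a::comm_monoid_add"
  by (simp add: sum.Sigma)
    (rule sum.reindex_bij_witness[of _ "\<lambda>(m, p). (p + m, m)" "\<lambda>(p, m). (m, p - m)"], auto)

lemma sum_triangle':
  "(\<Sum>p\<le>k. \<Sum>m = 1..k - p. F m p (k - p - m)) = (\<Sum>m = 1..k. \<Sum>p\<le>k - m. F m p (k - m - p))"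
  for F :: "nat \<Rightarrow> nat \<Rightarrow> nat \<Rightarrow> 'a::comm_monoid_add"
  by (simp add: sum.Sigma)
    (rule sum.reindex_bij_witness[of _ "\<lambda>(m, p). (p, m)" "\<lambda>(p, m). (m, p)"],
      auto simp: add.commute)

context scalars
begin

text \<open>The coefficient of $z^k w^l$ in
  $$\frac{(1 - a z w^{-1})(1 - b z w C)}{(1 - b z w^{-1})(1 - a z w C)} \sum_{l} Y_l w^l,$$
  where \<open>Cq q\<close> stands for $C^q$. The summand \<open>p\<close> takes $(z w^{-1})^p$ from the first quotient and
  $(z w C)^{k-p}$ from the second.\<close>

definition transfer_coeff :: "(nat \<Rightarrow> 'b) \<Rightarrow> qv \<Rightarrow> qv \<Rightarrow> (int \<Rightarrow> 'b) \<Rightarrow> nat \<Rightarrow> int \<Rightarrow> 'b" where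
  "transfer_coeff Cq a b Y k l =
     (\<Sum>p\<le>k. s (mobius a b p * mobius b a (k - p)) * (Cq (k - p) * Y (l + int p - int (k - p))))"

lemma transfer_coeff_0:
  assumes "Cq 0 = s 1" "\<And>l. Y l \<in> U"
  shows "transfer_coeff Cq a b Y 0 l = Y l"
  using assms by (simp add: transfer_coeff_def mobius_def U_one)

text \<open>The logarithmic derivative of the structure function, in coefficients: the part of
  \<open>of_nat k = of_nat p + of_nat (k - p)\<close> belonging to $p$ differentiates the first Moebius function and shifts
  $l$ upwards, the other part differentiates the second one, in which $a$ and $b$ have changed places,
  and contributes with the opposite sign and a factor $C^m$.\<close>

lemma transfer_coeff_recursion:
  assumes C_add: "\<And>m n. Cq (m + n) = Cq m * Cq n" and CU: "\<And>m. Cq m \<in> U"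
  shows "s (of_nat k) * transfer_coeff Cq a b Y k l =
    (\<Sum>m = 1..k. s (b ^ m - a ^ m) *
       (transfer_coeff Cq a b Y (k - m) (l + int m)
        - Cq m * transfer_coeff Cq a b Y (k - m) (l - int m)))"
proof -
  define T where "T p q r l' = s (mobius a b p * mobius b a q) * (Cq r * Y l')" for p q r l'
  have W: "transfer_coeff Cq a b Y k l = (\<Sum>p\<le>k. T p (k - p) (k - p) (l + int p - int (k - p)))" for k l
    by (simp add: transfer_coeff_def T_def)
  have CT: "Cq m * T p q r l' = T p q (m + r) l'" for m p q r l'
    using U_left_comm[OF CU] by (simp add: T_def C_add mult.assoc)
  have A: "s (of_nat p) * T p q r l' = (\<Sum>m = 1..p. s (b ^ m - a ^ m) * T (p - m) q r l')" for p q r l'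
  proof -
    have "s (of_nat p * mobius a b p * mobius b a q) =
        (\<Sum>m = 1..p. s (b ^ m - a ^ m) * s (mobius a b (p - m) * mobius b a q))"
      by (simp only: mobius_recursion sum_distrib_right s_sum s_mult[symmetric] mult.assoc)
    then have "s (of_nat p * mobius a b p * mobius b a q) * (Cq r * Y l') =
        (\<Sum>m = 1..p. s (b ^ m - a ^ m) * s (mobius a b (p - m) * mobius b a q) * (Cq r * Y l'))"
      by (simp only: sum_distrib_right)
    then show ?thesis by (simp only: T_def mult.assoc s_mult)
  qed
  have B: "s (of_nat q) * T p q r l' = - (\<Sum>m = 1..q. s (b ^ m - a ^ m) * T p (q - m) r l')" for p q r l'
  proof -
    have "of_nat q * mobius b a q = - (\<Sum>m = 1..q. (b ^ m - a ^ m) * mobius b a (q - m))"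
      unfolding mobius_recursion sum_negf[symmetric] by (rule sum.cong) (simp_all add: algebra_simps)
    then have "of_nat q * (mobius a b p * mobius b a q) =
        - (\<Sum>m = 1..q. (b ^ m - a ^ m) * (mobius a b p * mobius b a (q - m)))"
      unfolding mult.left_commute[of _ "mobius a b p"] sum_distrib_left[symmetric] by simp
    then have "s (of_nat q) * s (mobius a b p * mobius b a q) =
        - (\<Sum>m = 1..q. s (b ^ m - a ^ m) * s (mobius a b p * mobius b a (q - m)))"
      by (simp only: s_mult[symmetric] s_minus[symmetric] s_sum[symmetric])
    then have "s (of_nat q) * s (mobius a b p * mobius b a q) * (Cq r * Y l') =
        - (\<Sum>m = 1..q. s (b ^ m - a ^ m) * s (mobius a b p * mobius b a (q - m)) * (Cq r * Y l'))"
      by (simp only: sum_distrib_right minus_mult_left[symmetric])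
    then show ?thesis by (simp only: T_def mult.assoc)
  qed
  have "s (of_nat k) * transfer_coeff Cq a b Y k l =
      (\<Sum>p\<le>k. s (of_nat p) * T p (k - p) (k - p) (l + int p - int (k - p)))
      + (\<Sum>p\<le>k. s (of_nat (k - p)) * T p (k - p) (k - p) (l + int p - int (k - p)))"
    unfolding W sum_distrib_left sum.distrib[symmetric] distrib_right[symmetric] s_add[symmetric]
      of_nat_add[symmetric] by (rule sum.cong) auto
  also have "(\<Sum>p\<le>k. s (of_nat p) * T p (k - p) (k - p) (l + int p - int (k - p))) =
      (\<Sum>m = 1..k. \<Sum>p\<le>k - m. s (b ^ m - a ^ m) * T p (k - m - p) (k - m - p) (l + int m + int p - int (k - m - p)))"
    unfolding A
    by (subst sum_triangle[symmetric]) (intro sum.cong refl, auto simp: algebra_simps)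
  also have "(\<Sum>p\<le>k. s (of_nat (k - p)) * T p (k - p) (k - p) (l + int p - int (k - p))) =
      - (\<Sum>m = 1..k. \<Sum>p\<le>k - m. s (b ^ m - a ^ m) * T p (k - m - p) (m + (k - m - p)) (l - int m + int p - int (k - m - p)))"
    unfolding B sum_negf
    by (subst sum_triangle'[symmetric]) (intro arg_cong[of _ _ uminus] sum.cong refl, auto simp: of_nat_diff algebra_simps)
  finally show ?thesis
    by (simp only: W CT sum_distrib_left right_diff_distrib sum_subtractf diff_conv_add_uminus[symmetric])
qed

text \<open>The $\Theta$-relation in degree \<open>n\<close> and the $H$-relation in degree \<open>n\<close> imply each
  other once both hold in all lower degrees, because their failures then agree up to a factor. To see this, expand
  $n t_n Y_l = \sum_m m x_m t_{n-m} Y_l$, move every $Y$ to the left with the relations in lower degrees,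
  and recombine with Newton's recursion and \<open>transfer_coeff_recursion\<close>. Only for
  $m = n$ would this need the $H$-relation in degree \<open>n\<close> itself.\<close>

theorem current_commutation:
  assumes nt: "newton x t" and t0: "t 0 = s 1"
    and xU: "\<And>m. m \<ge> 1 \<Longrightarrow> x m \<in> U" and tU: "\<And>n. t n \<in> U" and YU: "\<And>l. Y l \<in> U"
    and CU: "\<And>m. Cq m \<in> U" and C0: "Cq 0 = s 1"
    and C_add: "\<And>m n. Cq (m + n) = Cq m * Cq n"
    and Cx: "\<And>m n. n \<ge> 1 \<Longrightarrow> x n * Cq m = Cq m * x n"
  shows "(\<forall>n l. t n * Y l = (\<Sum>k\<le>n. transfer_coeff Cq a b Y k l * t (n - k))) \<longleftrightarrow>
    (\<forall>m\<ge>1. \<forall>l. s (of_nat m) * (x m * Y l - Y l * x m) =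
      s (b ^ m - a ^ m) * (Y (l + int m) - Cq m * Y (l - int m)))"
    (is "(\<forall>n l. ?T n l) \<longleftrightarrow> (\<forall>m\<ge>1. \<forall>l. ?X m l)")
proof -
  let ?W = "transfer_coeff Cq a b Y"
  define V where "V m k l = s (b ^ m - a ^ m) * (?W k (l + int m) - Cq m * ?W k (l - int m))" for m k l
  have WU: "?W k l \<in> U" for k l
    unfolding transfer_coeff_def by (intro U_sum U_mult U_s CU YU)
  have W0: "?W 0 l = Y l" for l
    using transfer_coeff_0[of Cq Y] C0 YU by simp
  \<comment> \<open>the \<open>H\<close>-relation extends from \<open>Y\<close> to all combinations of its shifts with coefficients in powers of \<open>C\<close>\<close>
  have XW: "s (of_nat m) * (x m * ?W k l) = ?W k l * (s (of_nat m) * x m) + V m k l"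
    if X: "\<And>l. ?X m l" and m: "m \<ge> 1" for m k l
  proof -
    have XY: "s (of_nat m) * (x m * Y l) = s (of_nat m) * (Y l * x m) + s (b ^ m - a ^ m) * (Y (l + int m) - Cq m * Y (l - int m))" for l
      using X[of l] by (simp add: right_diff_distrib algebra_simps)
    have summand: "s (of_nat m) * (x m * (s g * (Cq q * Y l))) =
        s g * (Cq q * Y l) * (s (of_nat m) * x m)
        + s (b ^ m - a ^ m) * (s g * (Cq q * Y (l + int m)) - Cq m * (s g * (Cq q * Y (l - int m))))" for g q l
    proof -
      have "s (of_nat m) * (x m * (s g * (Cq q * Y l))) = s g * (Cq q * (s (of_nat m) * (x m * Y l)))"
        using Cx[OF m, of q]
        by (metis (no_types, lifting) U_left_comm[OF xU[OF m]] U_left_comm[OF CU] U_left_comm[OF U_s] mult.assoc)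
      also have "\<dots> = s g * (Cq q * (s (of_nat m) * (Y l * x m)))
          + (s g * (Cq q * (s (b ^ m - a ^ m) * Y (l + int m)))
             - s g * (Cq q * (s (b ^ m - a ^ m) * (Cq m * Y (l - int m)))))"
        unfolding XY by (simp only: distrib_left right_diff_distrib)
      also have "s g * (Cq q * (s (of_nat m) * (Y l * x m))) = s g * (Cq q * Y l) * (s (of_nat m) * x m)"
        by (simp only: U_left_comm[OF YU] mult.assoc)
      also have "s g * (Cq q * (s (b ^ m - a ^ m) * Y (l + int m))) = s (b ^ m - a ^ m) * (s g * (Cq q * Y (l + int m)))"
        by (simp only: U_left_comm[OF CU] U_left_comm[OF U_s, of g])
      also have "s g * (Cq q * (s (b ^ m - a ^ m) * (Cq m * Y (l - int m)))) =
          s (b ^ m - a ^ m) * (Cq m * (s g * (Cq q * Y (l - int m))))"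
      proof -
        have "Cq q * (Cq m * Z) = Cq m * (Cq q * Z)" for Z
          by (simp only: mult.assoc[symmetric] C_add[symmetric] add.commute)
        then show ?thesis by (simp only: U_left_comm[OF CU] U_left_comm[OF U_s, of g])
      qed
      finally show ?thesis by (simp only: right_diff_distrib)
    qed
    have shift: "l + int p - int q + int m = l + int m + int p - int q"
      "l + int p - int q - int m = l - int m + int p - int q" for p q
      by simp_all
    show ?thesis
      unfolding V_def transfer_coeff_def sum_distrib_left sum_distrib_right sum_subtractf[symmetric] sum.distrib[symmetric]
      by (rule sum.cong) (simp_all only: summand shift)
  qed
  \<comment> \<open>\<open>n\<close> times the failure of the first relation in degree \<open>n\<close> is the failure of the second\<close>
  have key: "s (of_nat n) * (t n * Y l - (\<Sum>k\<le>n. ?W k l * t (n - k))) =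
      s (of_nat n) * (x n * Y l - Y l * x n) - V n 0 l"
    if n: "n \<ge> 1" and T: "\<And>k l. k < n \<Longrightarrow> ?T k l" and X: "\<And>m l. 1 \<le> m \<Longrightarrow> m < n \<Longrightarrow> ?X m l" for n l
  proof -
    have split: "{1..n} = insert n {1..<n}" using n by auto
    define P where "P m k = (?W k l * (s (of_nat m) * x m) + V m k l) * t (n - m - k)" for m k
    have "s (of_nat n) * (t n * Y l) = (\<Sum>m = 1..n. s (of_nat m) * (x m * t (n - m))) * Y l"
      using nt by (simp only: newton_def mult.assoc[symmetric])
    also have "\<dots> = (\<Sum>m = 1..<n. s (of_nat m) * (x m * (t (n - m) * Y l))) + s (of_nat n) * (x n * Y l)"
      unfolding sum_distrib_right split using t0 U_one(2)[OF xU[OF n]]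
      by (simp add: mult.assoc add.commute) (simp add: mult.assoc[symmetric])
    also have "(\<Sum>m = 1..<n. s (of_nat m) * (x m * (t (n - m) * Y l))) = (\<Sum>m = 1..<n. \<Sum>k\<le>n - m. P m k)"
    proof (rule sum.cong[OF refl])
      fix m assume m: "m \<in> {1..<n}"
      then have "s (of_nat m) * (x m * (t (n - m) * Y l)) = (\<Sum>k\<le>n - m. s (of_nat m) * (x m * ?W k l) * t (n - m - k))"
        using T[of "n - m"] by (simp add: sum_distrib_left mult.assoc)
      also have "\<dots> = (\<Sum>k\<le>n - m. P m k)"
        unfolding P_def using XW[OF X] m by simp
      finally show "s (of_nat m) * (x m * (t (n - m) * Y l)) = (\<Sum>k\<le>n - m. P m k)" .
    qed
    \<comment> \<open>adding the summand for \<open>m = n\<close>, where \<open>k = 0\<close>, completes the sum over all \<open>m \<ge> 1\<close> and \<open>k\<close> with \<open>m + k \<le> n\<close>\<close>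
    also have "\<dots> = (\<Sum>m = 1..n. \<Sum>k\<le>n - m. P m k) - P n 0"
      unfolding split by simp
    also have "(\<Sum>m = 1..n. \<Sum>k\<le>n - m. P m k) =
        (\<Sum>m = 1..n. \<Sum>k\<le>n - m. ?W k l * (s (of_nat m) * (x m * t (n - m - k))))
        + (\<Sum>m = 1..n. \<Sum>k\<le>n - m. V m k l * t (n - m - k))"
      by (simp only: P_def distrib_right mult.assoc sum.distrib)
    also have "(\<Sum>m = 1..n. \<Sum>k\<le>n - m. ?W k l * (s (of_nat m) * (x m * t (n - m - k)))) =
        (\<Sum>k\<le>n. ?W k l * (s (of_nat (n - k)) * t (n - k)))"
      using nt by (subst sum_triangle'[symmetric]) (simp only: newton_def sum_distrib_left)
    also have "(\<Sum>m = 1..n. \<Sum>k\<le>n - m. V m k l * t (n - m - k)) = (\<Sum>k\<le>n. (s (of_nat k) * ?W k l) * t (n - k))"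
      by (subst sum_triangle[symmetric])
        (simp only: transfer_coeff_recursion[OF C_add CU] V_def sum_distrib_right)
    also have "(\<Sum>k\<le>n. ?W k l * (s (of_nat (n - k)) * t (n - k))) + (\<Sum>k\<le>n. (s (of_nat k) * ?W k l) * t (n - k)) =
        s (of_nat n) * (\<Sum>k\<le>n. ?W k l * t (n - k))"
    proof -
      have "?W k l * (s (of_nat (n - k)) * t (n - k)) + (s (of_nat k) * ?W k l) * t (n - k) =
          s (of_nat n) * (?W k l * t (n - k))" if "k \<le> n" for k
      proof -
        have "s (of_nat n) = s (of_nat (n - k)) + s (of_nat k)"
          using that by (simp flip: s_add of_nat_add)
        then show ?thesis by (simp only: distrib_right U_left_comm[OF WU] mult.assoc)
      qed
      then show ?thesis by (simp add: sum_distrib_left sum.distrib[symmetric])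
    qed
    finally have "s (of_nat n) * (t n * Y l) = s (of_nat n) * (\<Sum>k\<le>n. ?W k l * t (n - k)) - P n 0 + s (of_nat n) * (x n * Y l)" .
    moreover have "P n 0 = s (of_nat n) * (Y l * x n) + V n 0 l"
    proof -
      have "P n 0 = (Y l * (s (of_nat n) * x n) + V n 0 l) * s 1"
        by (simp add: P_def W0 t0)
      moreover have "Y l * (s (of_nat n) * x n) + V n 0 l \<in> U"
        unfolding V_def by (intro U_add U_mult U_diff U_s WU YU CU xU n)
      ultimately show ?thesis by (simp add: U_one U_left_comm[OF YU])
    qed
    ultimately show ?thesis by (simp add: right_diff_distrib)
  qed
  have TX: "?T n l \<longleftrightarrow> ?X n l"
    if n: "n \<ge> 1" and "\<And>k l. k < n \<Longrightarrow> ?T k l" "\<And>m l. 1 \<le> m \<Longrightarrow> m < n \<Longrightarrow> ?X m l" for n l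
  proof -
    have "?T n l \<longleftrightarrow> s (of_nat n) * (t n * Y l - (\<Sum>k\<le>n. ?W k l * t (n - k))) = s (of_nat n) * 0"
      using n by (subst s_cancel) (auto intro!: U_diff U_mult U_sum tU YU WU)
    also have "\<dots> \<longleftrightarrow> ?X n l"
      by (subst key[of n l]) (use that in \<open>simp_all add: V_def W0\<close>)
    finally show ?thesis .
  qed
  have T0: "?T 0 l" for l
    by (simp add: W0 t0 U_one[OF YU])
  show ?thesis
  proof (intro iffI allI impI)
    fix m :: nat and l assume T: "\<forall>n l. ?T n l" and "m \<ge> 1"
    then have "\<forall>l. ?X m l"
    proof (induction m rule: less_induct)
      case (less m)
      then show ?case using TX[of m] by auto
    qed
    then show "?X m l" by blast
  next
    fix n l assume X: "\<forall>m\<ge>1. \<forall>l. ?X m l"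
    have "\<forall>l. ?T n l"
    proof (induction n rule: less_induct)
      case (less n)
      then show ?case using TX[of n] T0 X by (cases "n = 0") auto
    qed
    then show "?T n l" by blast
  qed
qed

end

section \<open>Coefficients of formal distributions\<close>

text \<open>The injection matches the two supports. If they are infinite, both sums are zero by
  convention.\<close>

lemma Sum_any_reindex_inj:
  assumes "inj h" "\<And>d. d \<notin> range h \<Longrightarrow> F d = 0"
  shows "Sum_any F = Sum_any (\<lambda>k. F (h k))"
proof -
  have eq: "{d. F d \<noteq> 0} = h ` {k. F (h k) \<noteq> 0}"
    using assms(2) by (auto simp: image_iff) (metis rangeE)
  have "Sum_any F = sum F (h ` {k. F (h k) \<noteq> 0})"
    by (simp only: Sum_any.expand_set eq)
  also have "\<dots> = sum (\<lambda>k. F (h k)) {k. F (h k) \<noteq> 0}"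
    by (rule sum.reindex_cong[of h]) (use assms(1) in \<open>auto intro: inj_on_subset\<close>)
  finally show ?thesis by (simp only: Sum_any.expand_set[of "\<lambda>k. F (h k)"])
qed

lemma Sum_any_eq_sum:
  assumes "finite A" "inj_on h A" "\<And>d. d \<notin> h ` A \<Longrightarrow> F d = 0"
  shows "Sum_any F = (\<Sum>k\<in>A. F (h k))"
proof -
  have "Sum_any F = sum F (h ` A)"
    by (rule Sum_any.expand_superset) (use assms in auto)
  then show ?thesis using assms(2) by (simp add: sum.reindex)
qed

lemma Sum_any_delta2:
  fixes X :: "'a::comm_monoid_add"
  assumes "\<And>k. F k = (if k = a then X else 0) + (if k = b then Y else 0)"
  shows "Sum_any F = X + Y"
proof -
  have "Sum_any F = Sum_any (\<lambda>k. if k = a then X else 0) + Sum_any (\<lambda>k. if k = b then Y else 0)"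
    unfolding assms by (rule Sum_any.distrib) auto
  then show ?thesis by simp
qed

lemma Sum_any_delta1:
  assumes "\<And>k. F k = (if k = a then X else 0)"
  shows "Sum_any F = X"
  unfolding assms by simp

lemma fd_apply:
  fixes f g :: "'a::ring_1 fdist"
  shows "(f + g) e = f e + g e" "(f - g) e = f e - g e" "(- f) e = - f e"
  by (simp_all add: plus_fun_def fun_diff_def fun_Compl_def)

lemma expo_mult_eq: "expo_mult k u = (k * fst u, k * fst (snd u), k * snd (snd u))"
  by (cases u) simp

lemma inj_expo_mult: "u \<noteq> 0 \<Longrightarrow> inj (\<lambda>k. expo_mult k u)"
  by (rule injI) (auto simp: expo_mult_eq zero_prod_def prod_eq_iff)

lemma bilat_multiple: "u \<noteq> 0 \<Longrightarrow> bilat a u (expo_mult k u) = a k"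
proof -
  assume "u \<noteq> 0"
  then have "{k'. expo_mult k' u = expo_mult k u} = {k}"
    by (simp add: inj_eq[OF inj_expo_mult])
  then show ?thesis by (simp add: bilat_def)
qed

lemma bilat_other: "e \<notin> range (\<lambda>k. expo_mult k u) \<Longrightarrow> bilat a u e = 0"
proof -
  assume "e \<notin> range (\<lambda>k. expo_mult k u)"
  then have "{k. expo_mult k u = e} = {}" by auto
  then show ?thesis by (simp add: bilat_def)
qed

text \<open>Multiplying by a one-variable series turns the convolution over exponent vectors into a
  sum over one integer. All coefficients of the relations are computed from this by counting for how
  many integers the summand can be nonzero: at most two in most cases.\<close>

lemma bilat_mult_left:
  assumes "u \<noteq> 0"
  shows "(bilat a u \<star> f) e = Sum_any (\<lambda>k. a k * f (e - expo_mult k u))"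
  unfolding fd_mult_def
  by (subst Sum_any_reindex_inj[OF inj_expo_mult[OF assms]])
     (simp_all add: bilat_other bilat_multiple[OF assms])

lemma fd_mult_right: "(f \<star> g) e = Sum_any (\<lambda>d. f (e - d) * g d)"
  unfolding fd_mult_def
  by (rule Sum_any.reindex_cong[of "\<lambda>d. e - d"])
     (auto simp: fun_eq_iff intro!: bijI injI surjI[of _ "\<lambda>d. e - d"])

lemma bilat_mult_right:
  assumes "u \<noteq> 0"
  shows "(f \<star> bilat a u) e = Sum_any (\<lambda>k. f (e - expo_mult k u) * a k)"
  unfolding fd_mult_right
  by (subst Sum_any_reindex_inj[OF inj_expo_mult[OF assms]])
     (simp_all add: bilat_other bilat_multiple[OF assms])

lemma mon_mult_left: "(mon a u \<star> f) e = a * f (e - u)"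
  unfolding fd_mult_def by (rule Sum_any_delta1[of _ u]) (simp add: mon_def)

lemma mon_mult_right: "(f \<star> mon a u) e = f (e - u) * a"
  unfolding fd_mult_right by (rule Sum_any_delta1[of _ u]) (simp add: mon_def)

lemma mon_add_mult_left: "((mon a u + mon b w) \<star> f) e = a * f (e - u) + b * f (e - w)"
  unfolding fd_mult_def
  by (rule Sum_any_delta2[of _ u _ w]) (simp add: mon_def distrib_right)

lemma mon_diff_eq: "mon a u - mon b w = mon a u + mon (- b) w"
  by (auto simp: mon_def fun_eq_iff)

lemma mon_diff_mult_left: "((mon a u - mon b w) \<star> f) e = a * f (e - u) - b * f (e - w)"
  using mon_add_mult_left[of a u "- b" w f e]
  by (simp add: mon_diff_eq)

lemma mon_add_mult_right: "(f \<star> (mon a u + mon b w)) e = f (e - u) * a + f (e - w) * b"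
  unfolding fd_mult_right
  by (rule Sum_any_delta2[of _ u _ w]) (simp add: mon_def distrib_left)

lemma mon_diff_mult_right: "(f \<star> (mon a u - mon b w)) e = f (e - u) * a - f (e - w) * b"
  using mon_add_mult_right[of f a u "- b" w e]
  by (simp add: mon_diff_eq)

lemma mon_0_bilat: "mon a 0 \<star> bilat b u = bilat (\<lambda>k. a * b k) u"
  by (rule ext) (simp add: mon_mult_left bilat_def sum_distrib_left)

lemma bilat_variable:
  "bilat a x1 (p, q, r) = (if q = 0 \<and> r = 0 then a p else 0)"
  "bilat a x2 (p, q, r) = (if p = 0 \<and> r = 0 then a q else 0)"
  "bilat a x3 (p, q, r) = (if p = 0 \<and> q = 0 then a r else 0)"
proof -
  have "{k. expo_mult k x1 = (p, q, r)} = (if q = 0 \<and> r = 0 then {p} else {})"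
    "{k. expo_mult k x2 = (p, q, r)} = (if p = 0 \<and> r = 0 then {q} else {})"
    "{k. expo_mult k x3 = (p, q, r)} = (if p = 0 \<and> q = 0 then {r} else {})"
    by auto
  then show "bilat a x1 (p, q, r) = (if q = 0 \<and> r = 0 then a p else 0)"
    "bilat a x2 (p, q, r) = (if p = 0 \<and> r = 0 then a q else 0)"
    "bilat a x3 (p, q, r) = (if p = 0 \<and> q = 0 then a r else 0)"
    by (simp_all add: bilat_def)
qed

lemma expo_nonzero:
  "x1 \<noteq> 0" "x2 \<noteq> 0" "x3 \<noteq> 0" "x1 + x2 \<noteq> 0" "x1 - x2 \<noteq> 0" "x2 - x1 \<noteq> 0"
  by (simp_all add: zero_prod_def)

lemmas bilat_left = expo_nonzero[THEN bilat_mult_left]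
lemmas bilat_right = expo_nonzero[THEN bilat_mult_right]

lemma bilat_x1_x2: "(bilat a x1 \<star> bilat b x2) (p, q, r) = (if r = 0 then a p * b q else 0)"
  unfolding bilat_left by (rule Sum_any_delta1[of _ p]) (simp add: bilat_variable)

lemma bilat_x2_x1: "(bilat b x2 \<star> bilat a x1) (p, q, r) = (if r = 0 then b q * a p else 0)"
  unfolding bilat_left by (rule Sum_any_delta1[of _ q]) (simp add: bilat_variable)

lemma bilat_x2_x3: "(bilat b x2 \<star> bilat a x3) (p, q, r) = (if p = 0 then b q * a r else 0)"
  unfolding bilat_left by (rule Sum_any_delta1[of _ q]) (simp add: bilat_variable)

lemma bilat_x3_x2: "(bilat a x3 \<star> bilat b x2) (p, q, r) = (if p = 0 then a r * b q else 0)"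
  unfolding bilat_left by (rule Sum_any_delta1[of _ r]) (simp add: bilat_variable)

lemma bilat_x1_x3: "(bilat b x1 \<star> bilat a x3) (p, q, r) = (if q = 0 then b p * a r else 0)"
  unfolding bilat_left by (rule Sum_any_delta1[of _ p]) (simp add: bilat_variable)

lemma bilat_x3_x1: "(bilat a x3 \<star> bilat b x1) (p, q, r) = (if q = 0 then a r * b p else 0)"
  unfolding bilat_left by (rule Sum_any_delta1[of _ r]) (simp add: bilat_variable)

lemma bilat_x1_x2_x3: "(bilat a x1 \<star> bilat b x2 \<star> bilat c x3) (p, q, r) = a p * b q * c r"
  by (rule trans[OF bilat_right(3)], rule Sum_any_delta1[of _ r]) (simp add: bilat_x1_x2)

lemma bilat_x1_x3_x2: "(bilat a x1 \<star> bilat c x3 \<star> bilat b x2) (p, q, r) = a p * c r * b q"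
  by (rule trans[OF bilat_right(2)], rule Sum_any_delta1[of _ q]) (simp add: bilat_x1_x3)

lemma bilat_x3_x1_x2: "(bilat c x3 \<star> bilat a x1 \<star> bilat b x2) (p, q, r) = c r * a p * b q"
  by (rule trans[OF bilat_right(2)], rule Sum_any_delta1[of _ q]) (simp add: bilat_x3_x1)

text \<open>The linear factors of the quadratic relations turn the product of two currents into a
  difference of neighbouring products.\<close>

lemma binomial_x1_x2:
  "((mon \<alpha> x1 - mon 1 x2) \<star> bilat a x1 \<star> bilat b x2) (p, q, r) =
    (if r = 0 then \<alpha> * a (p - 1) * b q - a p * b (q - 1) else 0)"
proof -
  have "((mon \<alpha> x1 - mon 1 x2) \<star> bilat a x1 \<star> bilat b x2) (p, q, r) =
      (if r = 0 then \<alpha> * a (p - 1) * b q else 0) + (if r = 0 then - (a p * b (q - 1)) else 0)"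
    by (rule trans[OF bilat_right(2)], rule Sum_any_delta2[of _ q _ "q - 1"])
       (auto simp add: mon_diff_mult_left bilat_variable algebra_simps)
  then show ?thesis by simp
qed

lemma binomial_x2_x1:
  "((mon \<alpha> x2 - mon 1 x1) \<star> bilat b x2 \<star> bilat a x1) (p, q, r) =
    (if r = 0 then \<alpha> * b (q - 1) * a p - b q * a (p - 1) else 0)"
proof -
  have "((mon \<alpha> x2 - mon 1 x1) \<star> bilat b x2 \<star> bilat a x1) (p, q, r) =
      (if r = 0 then \<alpha> * b (q - 1) * a p else 0) + (if r = 0 then - (b q * a (p - 1)) else 0)"
    by (rule trans[OF bilat_right(1)], rule Sum_any_delta2[of _ p _ "p - 1"])
       (auto simp add: mon_diff_mult_left bilat_variable algebra_simps)
  then show ?thesis by simp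
qed

section \<open>Coefficients of the defining relations\<close>

text \<open>The coefficients of $\boldsymbol\Theta_i$, extended by $1$ at $0$ and by zero to negative
  indices; this makes $\boldsymbol\Theta_i$ a series of the form \<open>bilat\<close>.\<close>

definition Theta_coeff :: "'i \<Rightarrow> int \<Rightarrow> 'i gf_gen free" where
  "Theta_coeff i m = (if m < 0 then 0 else if m = 0 then 1 else scal (v - inverse v) * gTheta i (nat m))"

lemma Theta_coeff_0 [simp]: "Theta_coeff i 0 = 1" and Theta_coeff_neg [simp]: "m < 0 \<Longrightarrow> Theta_coeff i m = 0"
  by (simp_all add: Theta_coeff_def)

lemma Th_eq_bilat: "u \<noteq> 0 \<Longrightarrow> Th i u = bilat (Theta_coeff i) u"
proof
  fix e assume u: "u \<noteq> 0"
  have 0: "expo_mult 0 u = 0"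
    by (simp add: expo_mult_eq zero_prod_def)
  show "Th i u e = bilat (Theta_coeff i) u e"
  proof (cases "e \<in> range (\<lambda>k. expo_mult k u)")
    case True
    then obtain k where e: "e = expo_mult k u" by auto
    have "e = 0 \<longleftrightarrow> k = 0"
      using injD[OF inj_expo_mult[OF u], of k 0] 0 e by auto
    moreover have "bilat a u 0 = a 0" for a :: "int \<Rightarrow> 'a gf_gen free"
      using bilat_multiple[OF u, of a 0] 0 by simp
    ultimately show ?thesis
      by (cases "k = 0") (auto simp: Th_def mon_def Theta_coeff_def e fd_apply bilat_multiple[OF u])
  next
    case False
    then have "e \<noteq> 0" using 0 by (metis rangeI)
    then show ?thesis using False by (simp add: Th_def mon_def fd_apply bilat_other)
  qed
qed

lemmas Th_bilat = expo_nonzero[THEN Th_eq_bilat]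

lemma coeff_rel_a:
  "rel_a i j x1 x2 (p, q, r) = (if r = 0 then Theta_coeff i p * Theta_coeff j q - Theta_coeff j q * Theta_coeff i p else 0)"
  by (simp add: rel_a_def Th_bilat fd_apply bilat_x1_x2 bilat_x2_x1)

lemma coeff_rel_c:
  "rel_c i j x1 x2 (p, q, r) = (if r = 0 then gB i q * gB j p - gB j p * gB i q else 0)"
  by (simp add: rel_c_def BB_def fd_apply bilat_x1_x2 bilat_x2_x1)

lemma coeff_rel_d:
  "rel_d c i j x1 x2 (p, q, r) =
    (if r = 0 then (scal (v powi (c i j)) * gB i (p - 1) * gB j q - gB i p * gB j (q - 1))
       + (scal (v powi (c i j)) * gB j (q - 1) * gB i p - gB j q * gB i (p - 1)) else 0)"
  by (simp add: rel_d_def BB_def fd_apply binomial_x1_x2 binomial_x2_x1)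

text \<open>The factor $\boldsymbol\Delta(z w)$ contributes $C^k$ for one \<open>k\<close> per monomial: the
  products $z \boldsymbol\Theta_i(w)$, $w \boldsymbol\Theta_i(w)$, $w \boldsymbol\Theta_i(z)$ and $z \boldsymbol\Theta_i(z)$ fix
  $k = p - 1$, $p$, $q - 1$ and $q$ in turn.\<close>

lemma coeff_rel_e:
  "rel_e i x1 x2 (p, q, r) =
    (if r = 0 then (scal (v ^ 2) * gB i (p - 1) * gB i q - gB i p * gB i (q - 1))
       + (scal (v ^ 2) * gB i (q - 1) * gB i p - gB i q * gB i (p - 1))
       - (scal (v powi (- 2) / (v - inverse v)) * gK i) *
         ((gCpow (p - 1) * (scal (v ^ 2) * Theta_coeff i (q - p + 1)) - gCpow p * Theta_coeff i (q - p - 1))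
         + (gCpow (q - 1) * (scal (v ^ 2) * Theta_coeff i (p - q + 1)) - gCpow q * Theta_coeff i (p - q - 1)))
     else 0)"
proof -
  let ?\<kappa> = "scal (v powi (- 2) / (v - inverse v)) * gK i"
  let ?F = "(mon (scal (v ^ 2)) x1 - mon 1 x2) \<star> Th i x2 + (mon (scal (v ^ 2)) x2 - mon 1 x1) \<star> Th i x1"
  define G where "G k = ?\<kappa> * gCpow k * ?F (p - k, q - k, r)" for k
  define A where "A = (if r = 0 then ?\<kappa> * gCpow (p - 1) * (scal (v ^ 2) * Theta_coeff i (q - p + 1)) else 0)"
  define B where "B = (if r = 0 then - (?\<kappa> * gCpow p * Theta_coeff i (q - p - 1)) else 0)"
  define A' where "A' = (if r = 0 then ?\<kappa> * gCpow (q - 1) * (scal (v ^ 2) * Theta_coeff i (p - q + 1)) else 0)"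
  define B' where "B' = (if r = 0 then - (?\<kappa> * gCpow q * Theta_coeff i (p - q - 1)) else 0)"
  have "(mon ?\<kappa> 0 \<star> Delta (x1 + x2) \<star> ?F) (p, q, r) = Sum_any G"
    unfolding Delta_def mon_0_bilat bilat_mult_left[OF expo_nonzero(4)] G_def
    by (rule Sum_any.cong) simp
  also have "Sum_any G = Sum_any (\<lambda>k. ((if k = p - 1 then A else 0) + (if k = p then B else 0))
      + ((if k = q - 1 then A' else 0) + (if k = q then B' else 0)))"
    by (rule Sum_any.cong)
      (auto simp: G_def A_def B_def A'_def B'_def fd_apply mon_diff_mult_left Th_bilat bilat_variable
        distrib_left right_diff_distrib algebra_simps)
  also have "\<dots> = Sum_any (\<lambda>k. (if k = p - 1 then A else 0) + (if k = p then B else 0))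
      + Sum_any (\<lambda>k. (if k = q - 1 then A' else 0) + (if k = q then B' else 0))"
    by (rule Sum_any.distrib) (rule finite_subset[of _ "{p - 1, p, q - 1, q}"], auto)+
  also have "\<dots> = (A + B) + (A' + B')"
    by (simp only: Sum_any_delta2[OF refl])
  finally show ?thesis
    by (simp add: rel_e_def BB_def fd_apply binomial_x1_x2 binomial_x2_x1
        A_def B_def A'_def B'_def distrib_left right_diff_distrib mult.assoc)
qed

text \<open>The Serre relation is symmetric in its first two variables. Composition with the exchange of
  coordinates carries the formulas for one half to the other half.\<close>

definition swap12 :: "expo \<Rightarrow> expo" where
  "swap12 e = (fst (snd e), fst e, snd (snd e))"

lemma swap12_simps [simp]:
  "swap12 (p, q, r) = (q, p, r)" "swap12 (swap12 e) = e" "swap12 (d + e) = swap12 d + swap12 e"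
  "swap12 (d - e) = swap12 d - swap12 e" "swap12 0 = 0" "swap12 d = swap12 e \<longleftrightarrow> d = e"
  by (auto simp: swap12_def prod_eq_iff)

lemma bij_swap12: "bij swap12"
  by (rule involuntory_imp_bij) simp

lemma fd_mult_swap12: "(f \<star> g) (swap12 e) = ((f \<circ> swap12) \<star> (g \<circ> swap12)) e"
  unfolding fd_mult_def by (rule Sum_any.reindex_cong[OF bij_swap12]) (simp add: fun_eq_iff)

lemma mon_swap12: "mon a (swap12 u) = mon a u \<circ> swap12"
proof
  fix e
  have "e = swap12 u \<longleftrightarrow> swap12 e = u" by (metis swap12_simps(2))
  then show "mon a (swap12 u) e = (mon a u \<circ> swap12) e" by (simp add: mon_def)
qed

lemma bilat_swap12: "bilat a (swap12 u) = bilat a u \<circ> swap12"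
proof
  fix e
  have "expo_mult k (swap12 u) = e \<longleftrightarrow> expo_mult k u = swap12 e" for k
    by (cases u, cases e) auto
  then show "bilat a (swap12 u) e = (bilat a u \<circ> swap12) e"
    by (simp add: bilat_def)
qed

lemma comp_swap12:
  "(f \<star> g) \<circ> swap12 = (f \<circ> swap12) \<star> (g \<circ> swap12)"
  "(f + g) \<circ> swap12 = (f \<circ> swap12) + (g \<circ> swap12)"
  "(f - g) \<circ> swap12 = (f \<circ> swap12) - (g \<circ> swap12)"
  "(- f) \<circ> swap12 = - (f \<circ> swap12)"
  by (auto simp: fun_eq_iff fd_mult_swap12 fd_apply)

lemma series_swap12:
  "BB i (swap12 u) = BB i u \<circ> swap12" "Delta (swap12 u) = Delta u \<circ> swap12"
  "geom b (swap12 u) = geom b u \<circ> swap12" "Th i (swap12 u) = Th i u \<circ> swap12"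
  by (simp_all add: BB_def Delta_def geom_def Th_def bilat_swap12 comp_swap12 mon_swap12[of _ 0, simplified, symmetric])

lemma lhs_f_swap12: "lhs_f i j (swap12 w1) (swap12 w2) (swap12 z) = lhs_f i j w1 w2 z \<circ> swap12"
  by (simp add: lhs_f_def comp_swap12 series_swap12 mon_swap12[of _ 0, simplified, symmetric])

lemma rhs_f_swap12: "rhs_f i j (swap12 w1) (swap12 w2) (swap12 z) = rhs_f i j w1 w2 z \<circ> swap12"
  by (simp add: rhs_f_def fd_qcomm_def comp_swap12 series_swap12 mon_swap12
      mon_swap12[of _ 0, simplified, symmetric] flip: swap12_simps(3,4))

lemma coeff_lhs_f:
  "lhs_f i j x1 x2 x3 (p, q, r) =
     gB i p * gB i q * gB j r - scal (qint 2) * gB i p * gB j r * gB i q + gB j r * gB i p * gB i q"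
  unfolding lhs_f_def BB_def mon_0_bilat
  by (simp add: fd_apply bilat_x1_x2_x3 bilat_x1_x3_x2 bilat_x3_x1_x2)

lemma coeff_qcomm_Th_B:
  "fd_qcomm a (Th i x2) (BB j x3) (p, q, r) = (if p = 0 then qcomm a (Theta_coeff i q) (gB j r) else 0)"
  unfolding fd_qcomm_def BB_def Th_bilat mon_0_bilat
  by (simp add: fd_apply bilat_x2_x3 bilat_x3_x2 qcomm_def)

lemma coeff_qcomm_B_Th:
  "fd_qcomm a (BB j x3) (Th i x2) (p, q, r) = (if p = 0 then qcomm a (gB j r) (Theta_coeff i q) else 0)"
  unfolding fd_qcomm_def BB_def Th_bilat mon_0_bilat
  by (simp add: fd_apply bilat_x2_x3 bilat_x3_x2 qcomm_def)

lemma qcomm_0 [simp]: "qcomm a 0 x = 0" "qcomm a x 0 = 0"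
  by (simp_all add: qcomm_def)

text \<open>Apart from the numerators, $w_1$ occurs only in $\boldsymbol\Delta(w_1 w_2)$ and in the geometric
  series in $w_2 w_1^{-1}$. If $\boldsymbol\Delta$ contributes $C^{p+n}$, the exponent of $w_1$ determines
  the power of $w_2 w_1^{-1}$ taken from the geometric series (namely \<open>n\<close> or \<open>n - 1\<close>), and the exponent of $w_2$
  then gives the index of $\Theta$. This index is negative for large \<open>n\<close>, which makes the sum finite.\<close>

lemma coeff_rhs_f:
  fixes p q r :: int
  defines "N \<equiv> nat (q - p) + 2"
  shows "rhs_f i j x1 x2 x3 (p, q, r) =
    - (\<Sum>n<N. gK i * scal (inverse (v - inverse v)) * gCpow (p + int n) *
        ((if n = 0 then 0 else qcomm (v powi (- 2)) (Theta_coeff i (q - p - 2 * int n + 1)) (gB j (r - 1))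
              * scal (qint 2) * scal (v ^ 2) ^ (n - 1))
         + qcomm (v powi (- 2)) (gB j r) (Theta_coeff i (q - p - 2 * int n))
              * (scal (v ^ 2) ^ n + (if n = 0 then 0 else scal (v ^ 2) ^ (n - 1)))))"
proof -
  let ?g = "geom (scal (v ^ 2)) (x2 - x1)"
  let ?Q = "fd_qcomm (v powi (- 2)) (Th i x2) (BB j x3)" and ?Q' = "fd_qcomm (v powi (- 2)) (BB j x3) (Th i x2)"
  let ?c = "\<lambda>k. if k \<ge> 0 then scal (v ^ 2) ^ nat k else 0"
  let ?\<kappa> = "gK i * scal (inverse (v - inverse v))"
  define G where "G k = (if k \<ge> 1 then qcomm (v powi (- 2)) (Theta_coeff i (q - p - 2 * k + 1)) (gB j (r - 1)) * scal (qint 2) * ?c (k - 1) else 0)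
         + qcomm (v powi (- 2)) (gB j r) (Theta_coeff i (q - p - 2 * k)) * (?c k + ?c (k - 1))" for k
  have 1: "(?Q \<star> mon (scal (qint 2)) (x3 - x1) \<star> ?g) (p - k, q - k, r) =
      (if k - p \<ge> 1 then qcomm (v powi (- 2)) (Theta_coeff i (q - p - 2 * (k - p) + 1)) (gB j (r - 1)) * scal (qint 2) * ?c (k - p - 1) else 0)" for k
    unfolding geom_def
    by (rule trans[OF bilat_right(6)], rule Sum_any_delta1[of _ "k - p - 1"])
       (auto simp: mon_mult_right coeff_qcomm_Th_B algebra_simps)
  have 2: "(?Q' \<star> (mon 1 0 + mon 1 (x2 - x1)) \<star> ?g) (p - k, q - k, r) =
      qcomm (v powi (- 2)) (gB j r) (Theta_coeff i (q - p - 2 * (k - p))) * (?c (k - p) + ?c (k - p - 1))" for k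
    unfolding geom_def distrib_left
    by (rule trans[OF bilat_right(6)], rule Sum_any_delta2[of _ "k - p" _ "k - p - 1"])
       (auto simp: mon_add_mult_right coeff_qcomm_B_Th algebra_simps zero_prod_def)
  have e: "(p, q, r) - expo_mult k (x1 + x2) = (p - k, q - k, r)" for k
    by simp
  have "rhs_f i j x1 x2 x3 (p, q, r) = - Sum_any (\<lambda>k. ?\<kappa> * gCpow k * G (k - p))"
    unfolding rhs_f_def Delta_def mon_0_bilat G_def
    by (simp only: fd_apply bilat_left(4) e 1 2)
  also have "Sum_any (\<lambda>k. ?\<kappa> * gCpow k * G (k - p)) = (\<Sum>n<N. ?\<kappa> * gCpow (p + int n) * G (int n))"
  proof -
    have "Sum_any (\<lambda>k. ?\<kappa> * gCpow k * G (k - p)) = (\<Sum>n<N. ?\<kappa> * gCpow (p + int n) * G (p + int n - p))"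
    proof (rule Sum_any_eq_sum)
      fix k assume k: "k \<notin> (\<lambda>n. p + int n) ` {..<N}"
      have "k < p \<or> k \<ge> p + int N"
      proof (rule ccontr)
        assume "\<not> ?thesis"
        then have "k = p + int (nat (k - p))" "nat (k - p) \<in> {..<N}" by auto
        with k show False by blast
      qed
      then have "k < p \<or> q - p - 2 * (k - p) + 1 < 0 \<and> q - p - 2 * (k - p) < 0"
        unfolding N_def by (auto split: if_splits)
      then have "G (k - p) = 0" unfolding G_def by (elim disjE conjE) simp_all
      then show "?\<kappa> * gCpow k * G (k - p) = 0" by simp
    qed (auto intro: inj_onI)
    then show ?thesis by simp
  qed
  also have "\<dots> = (\<Sum>n<N. ?\<kappa> * gCpow (p + int n) *
        ((if n = 0 then 0 else qcomm (v powi (- 2)) (Theta_coeff i (q - p - 2 * int n + 1)) (gB j (r - 1))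
              * scal (qint 2) * scal (v ^ 2) ^ (n - 1))
         + qcomm (v powi (- 2)) (gB j r) (Theta_coeff i (q - p - 2 * int n))
              * (scal (v ^ 2) ^ n + (if n = 0 then 0 else scal (v ^ 2) ^ (n - 1)))))"
    by (rule sum.cong) (auto simp: G_def nat_diff_distrib)
  finally show ?thesis .
qed

section \<open>Expansion of the structure function\<close>

text \<open>Distributions in $z w^{-1}$ and $z w$: the coefficient of $(z w^{-1})^p (z w)^q$ is
  \<open>c p q\<close>. In terms of the exponents $x$ of $z$ and $y$ of $w$ this means $x = p + q$ and $y = q - p$,
  so that only exponents with even sum occur.\<close>

definition skew :: "(int \<Rightarrow> int \<Rightarrow> 'a::ring_1) \<Rightarrow> 'a fdist" where
  "skew c e = (case e of (x, y, z) \<Rightarrow>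
     if z = 0 \<and> even (x + y) then c ((x - y) div 2) ((x + y) div 2) else 0)"

lemma skew_apply [simp]: "skew c (p + q, q - p, 0) = c p q"
  by (simp add: skew_def) blast

lemma skew_other: "\<not> (z = 0 \<and> even (x + y)) \<Longrightarrow> skew c (x, y, z) = 0"
  unfolding skew_def by auto

lemma even_sum_coordinates: "even (x + y) \<Longrightarrow> \<exists>p q. x = p + q \<and> y = q - p" for x y :: int
  by presburger

text \<open>A numerator of degree at most one leaves at most two nonzero summands in the product with
  the geometric series.\<close>

lemma skew_mult_geom_p:
  assumes "\<And>p q. p \<noteq> 0 \<Longrightarrow> p \<noteq> 1 \<Longrightarrow> c p q = 0"
  shows "skew c \<star> geom b (x1 - x2) =
    skew (\<lambda>p q. (if p \<ge> 0 then c 0 q * b ^ nat p else 0) + (if p \<ge> 1 then c 1 q * b ^ nat (p - 1) else 0))"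
proof (rule ext, clarify)
  fix x y z :: int
  show "(skew c \<star> geom b (x1 - x2)) (x, y, z) = skew (\<lambda>p q. (if p \<ge> 0 then c 0 q * b ^ nat p else 0)
      + (if p \<ge> 1 then c 1 q * b ^ nat (p - 1) else 0)) (x, y, z)" (is "_ = ?R")
  proof (cases "z = 0 \<and> even (x + y)")
    case True
    then obtain p q where xy: "x = p + q" "y = q - p"
      using even_sum_coordinates by blast
    have term_k: "skew c ((p + q, q - p, 0) - expo_mult k (x1 - x2)) = c (p - k) q" for k
      using skew_apply[of c "p - k" q] by (simp add: algebra_simps)
    have "(skew c \<star> geom b (x1 - x2)) (p + q, q - p, 0) =
        (if p \<ge> 0 then c 0 q * b ^ nat p else 0) + (if p \<ge> 1 then c 1 q * b ^ nat (p - 1) else 0)"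
      unfolding geom_def
      by (rule trans[OF bilat_right(5)], rule Sum_any_delta2[of _ p _ "p - 1"])
         (unfold term_k, use assms[of "p - _" q] in auto)
    then show ?thesis using True by (simp add: xy)
  next
    case False
    have "skew c ((x, y, z) - expo_mult k (x1 - x2)) = 0" for k
      using False by (auto intro!: skew_other)
    then show ?thesis unfolding geom_def bilat_right by (simp only: skew_other[OF False] mult_zero_left Sum_any.neutral)
  qed
qed

lemma skew_mult_geom_q:
  assumes "\<And>p q. q \<noteq> 0 \<Longrightarrow> q \<noteq> 1 \<Longrightarrow> c p q = 0"
  shows "skew c \<star> geom b (x1 + x2) =
    skew (\<lambda>p q. (if q \<ge> 0 then c p 0 * b ^ nat q else 0) + (if q \<ge> 1 then c p 1 * b ^ nat (q - 1) else 0))"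
proof (rule ext, clarify)
  fix x y z :: int
  show "(skew c \<star> geom b (x1 + x2)) (x, y, z) = skew (\<lambda>p q. (if q \<ge> 0 then c p 0 * b ^ nat q else 0)
      + (if q \<ge> 1 then c p 1 * b ^ nat (q - 1) else 0)) (x, y, z)" (is "_ = ?R")
  proof (cases "z = 0 \<and> even (x + y)")
    case True
    then obtain p q where xy: "x = p + q" "y = q - p"
      using even_sum_coordinates by blast
    have term_k: "skew c ((p + q, q - p, 0) - expo_mult k (x1 + x2)) = c p (q - k)" for k
      using skew_apply[of c p "q - k"] by (simp add: algebra_simps)
    have "(skew c \<star> geom b (x1 + x2)) (p + q, q - p, 0) =
        (if q \<ge> 0 then c p 0 * b ^ nat q else 0) + (if q \<ge> 1 then c p 1 * b ^ nat (q - 1) else 0)"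
      unfolding geom_def
      by (rule trans[OF bilat_right(4)], rule Sum_any_delta2[of _ q _ "q - 1"])
         (unfold term_k, use assms[of "q - _" p] in auto)
    then show ?thesis using True by (simp add: xy)
  next
    case False
    have "skew c ((x, y, z) - expo_mult k (x1 + x2)) = 0" for k
      using False by (auto intro!: skew_other)
    then show ?thesis unfolding geom_def bilat_right by (simp only: skew_other[OF False] mult_zero_left Sum_any.neutral)
  qed
qed

lemma skew_numerators:
  "(mon 1 0 - mon a (x1 - x2)) \<star> (mon 1 0 - mon b (x1 + x2)) =
    skew (\<lambda>p q. (if p = 0 then 1 else if p = 1 then - a else 0) * (if q = 0 then 1 else if q = 1 then - b else 0))"
proof (rule ext, clarify)
  fix x y z :: int
  show "((mon 1 0 - mon a (x1 - x2)) \<star> (mon 1 0 - mon b (x1 + x2))) (x, y, z) =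
    skew (\<lambda>p q. (if p = 0 then 1 else if p = 1 then - a else 0) * (if q = 0 then 1 else if q = 1 then - b else 0)) (x, y, z)"
  proof (cases "z = 0 \<and> even (x + y)")
    case True
    then obtain p q where xy: "x = p + q" "y = q - p"
      using even_sum_coordinates by blast
    show ?thesis using True
      by (auto simp: mon_diff_mult_right fd_apply mon_def xy skew_def zero_prod_def)
  next
    case False
    then show ?thesis by (auto simp: mon_diff_mult_right fd_apply mon_def skew_def zero_prod_def)
  qed
qed

definition structure_series :: "qv \<Rightarrow> qv \<Rightarrow> 'i gf_gen free fdist" where
  "structure_series a b = skew (\<lambda>p q. if p \<ge> 0 \<and> q \<ge> 0
     then scal (mobius a b (nat p) * mobius b a (nat q)) * gC ^ nat q else 0)"

lemma structure_series_eq: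
  "(mon 1 0 - mon (scal a) (x1 - x2)) \<star> (mon 1 0 - mon (scal b * gC) (x1 + x2))
     \<star> geom (scal b) (x1 - x2) \<star> geom (scal a * gC) (x1 + x2) = structure_series a b"
proof -
  have pow: "(scal a * gC) ^ n = scal (a ^ n) * gC ^ n" for n
  proof (induction n)
    case (Suc n)
    then show ?case
      by (simp add: scal_mult mult.assoc) (simp only: scal_left_commute[of gC "a ^ n", unfolded scal_power] scal_power)
  qed simp
  define Z :: "'a gf_gen free" where "Z = scal b * gC"
  have Z: "Z * scal b ^ n = scal b ^ n * Z" for n
    using scal_central[of "b ^ n" Z] by (simp add: scal_power)
  let ?N = "\<lambda>(p::int) (q::int). (if p = 0 then 1 else if p = 1 then - scal a else 0) *
      (if q = 0 then 1 else if q = 1 then - Z else 0)"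
  let ?c = "\<lambda>(p::int) (q::int). (if p \<ge> 0 then ?N 0 q * scal b ^ nat p else 0) + (if p \<ge> 1 then ?N 1 q * scal b ^ nat (p - 1) else 0)"
  have g: "scal b ^ nat p + (if p \<ge> 1 then - scal a * scal b ^ nat (p - 1) else 0) = scal (mobius a b (nat p))"
    if "p \<ge> 0" for p
    using that by (simp add: mobius_def scal_diff scal_mult scal_power nat_diff_distrib)
  have c0: "?c p 0 = (if p \<ge> 0 then scal (mobius a b (nat p)) else 0)" for p
    using g[of p] by auto
  have c1: "?c p 1 = - (?c p 0 * Z)" for p
    by (simp add: left_diff_distrib mult.assoc Z)
  have "(if q \<ge> 0 then ?c p 0 * (scal a * gC) ^ nat q else 0)
      + (if q \<ge> 1 then ?c p 1 * (scal a * gC) ^ nat (q - 1) else 0) =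
     (if p \<ge> 0 \<and> q \<ge> 0 then scal (mobius a b (nat p) * mobius b a (nat q)) * gC ^ nat q else 0)" for p q
  proof (cases "p \<ge> 0 \<and> q \<ge> 1")
    case True
    then obtain n where q: "q = int (Suc n)"
      by (metis One_nat_def Suc_le_eq gr0_implies_Suc of_nat_1 of_nat_le_iff zero_le_imp_eq_int order_trans zero_le_one)
    have n: "nat (1 + int n) = Suc n" by linarith
    have "Z * (scal (a ^ n) * gC ^ n) = scal (b * a ^ n) * gC ^ Suc n"
      by (simp only: Z_def mult.assoc scal_left_commute[of gC] scal_mult power_Suc)
    then show ?thesis
      using True unfolding c1 c0 pow q
      by (simp add: n mobius_def[of b a] right_diff_distrib scal_diff left_diff_distrib mult.assoc)
        (simp add: scal_mult mult.assoc)
  next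
    case False
    then show ?thesis unfolding c1 c0 by (auto simp: mobius_def[of b a])
  qed
  then show ?thesis
    unfolding skew_numerators structure_series_def Z_def[symmetric]
    by (subst skew_mult_geom_p, simp) (subst skew_mult_geom_q, auto)
qed

definition free_transfer_coeff :: "qv \<Rightarrow> qv \<Rightarrow> (int \<Rightarrow> 'i gf_gen free) \<Rightarrow> nat \<Rightarrow> int \<Rightarrow> 'i gf_gen free" where
  "free_transfer_coeff a b Y k l =
     (\<Sum>p\<le>k. scal (mobius a b p * mobius b a (k - p)) * gC ^ (k - p) * Y (l + int p - int (k - p)))"

text \<open>For the coefficient of $z^k w^l$ the powers $p$ of $z w^{-1}$ and $q$ of $z w$ satisfy
  $p + q = k$, and the coefficient of $\mathbf{Y}(w)$ has index $l + p - q$.\<close>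

lemma coeff_structure_series_B:
  fixes Y :: "int \<Rightarrow> 'i gf_gen free"
  shows "(structure_series a b \<star> bilat Y x2) (k, l, r) =
    (if r = 0 \<and> k \<ge> 0 then free_transfer_coeff a b Y (nat k) l else 0)"
proof -
  let ?S = "structure_series a b :: 'i gf_gen free fdist"
  show ?thesis
  proof (cases "r = 0 \<and> k \<ge> 0")
    case True
    define h where "h p = l + int p - int (nat k - p)" for p
    have "(structure_series a b \<star> bilat Y x2) (k, l, r) =
        Sum_any (\<lambda>m. ?S (k, l - m, 0) * Y m)"
      using True by (simp add: bilat_right)
    also have "\<dots> = (\<Sum>p\<in>{..nat k}. ?S (k, l - h p, 0) * Y (h p))"
    proof (rule Sum_any_eq_sum)
      show "inj_on h {..nat k}" by (rule inj_onI) (auto simp: h_def)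
      fix m assume m: "m \<notin> h ` {..nat k}"
      have "?S (k, l - m, 0) = 0"
      proof (rule ccontr)
        assume nz: "?S (k, l - m, 0) \<noteq> 0"
        then have "even (k + (l - m))"
          unfolding structure_series_def skew_def by (auto split: if_splits)
        then obtain p q where pq: "k = p + q" "l - m = q - p"
          using even_sum_coordinates by blast
        with nz have "p \<ge> 0" "q \<ge> 0"
          unfolding structure_series_def skew_def by (auto split: if_splits)
        then have "m = h (nat p)" "nat p \<le> nat k"
          using pq by (auto simp: h_def nat_add_distrib)
        with m show False by blast
      qed
      then show "?S (k, l - m, 0) * Y m = 0" by simp
    qed simp
    also have "\<dots> = free_transfer_coeff a b Y (nat k) l"
      unfolding free_transfer_coeff_def
    proof (rule sum.cong[OF refl])
      fix p assume "p \<in> {..nat k}"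
      then obtain q where k: "k = int p + int q"
        using True by (metis atMost_iff nat_le_iff zle_iff_zadd nat_int_add of_nat_0_le_iff le_nat_iff)
      then have h: "l - h p = int q - int p" by (simp add: h_def nat_add_distrib)
      have "?S (k, l - h p, 0) = scal (mobius a b p * mobius b a q) * gC ^ q"
        unfolding h structure_series_def k skew_apply by simp
      then show "?S (k, l - h p, 0) * Y (h p) =
          scal (mobius a b p * mobius b a (nat k - p)) * gC ^ (nat k - p) * Y (l + int p - int (nat k - p))"
        by (simp add: h_def k nat_add_distrib)
    qed
    finally show ?thesis using True by simp
  next
    case False
    have "?S (k, l - m, r) = 0" for m
    proof (rule ccontr)
      assume nz: "?S (k, l - m, r) \<noteq> 0"
      then have "r = 0 \<and> even (k + (l - m))"
        unfolding structure_series_def skew_def by (auto split: if_splits)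
      moreover from this obtain p q where pq: "k = p + q" "l - m = q - p"
        using even_sum_coordinates by blast
      ultimately have "p \<ge> 0" "q \<ge> 0"
        using nz unfolding structure_series_def skew_def by (auto split: if_splits)
      with False \<open>r = 0 \<and> _\<close> pq show False by auto
    qed
    then show ?thesis using False by (auto simp: bilat_right)
  qed
qed

lemma coeff_rel_b:
  "rel_b c i j x1 x2 (n, l, r) =
    (if r = 0 \<and> n \<ge> 0 then Theta_coeff i n * gB j l
       - (\<Sum>k\<le>nat n. free_transfer_coeff (v powi (- c i j)) (v powi (c i j)) (gB j) k l * Theta_coeff i (n - int k))
     else 0)"
proof -
  let ?P = "structure_series (v powi (- c i j)) (v powi (c i j))"
  let ?W = "free_transfer_coeff (v powi (- c i j)) (v powi (c i j)) (gB j)"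
  have "(?P \<star> bilat (gB j) x2 \<star> bilat (Theta_coeff i) x1) (n, l, r) =
      (if r = 0 \<and> n \<ge> 0 then \<Sum>k\<le>nat n. ?W k l * Theta_coeff i (n - int k) else 0)"
  proof -
    have "(?P \<star> bilat (gB j) x2 \<star> bilat (Theta_coeff i) x1) (n, l, r) =
        Sum_any (\<lambda>m. (?P \<star> bilat (gB j) x2) (n - m, l, r) * Theta_coeff i m)"
      by (rule trans[OF bilat_right(1)]) simp
    also have "\<dots> = (\<Sum>k\<in>{..nat n}. (?P \<star> bilat (gB j) x2) (n - (n - int k), l, r) * Theta_coeff i (n - int k))"
    proof (rule Sum_any_eq_sum)
      fix m assume m: "m \<notin> (\<lambda>k. n - int k) ` {..nat n}"
      have "m < 0 \<or> n - m < 0"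
      proof (rule ccontr)
        assume "\<not> ?thesis"
        then have "m = n - int (nat (n - m))" "nat (n - m) \<le> nat n" by auto
        with m show False by blast
      qed
      then show "(?P \<star> bilat (gB j) x2) (n - m, l, r) * Theta_coeff i m = 0"
        by (auto simp: coeff_structure_series_B)
    qed (auto intro: inj_onI)
    finally show ?thesis by (auto simp: coeff_structure_series_B)
  qed
  then show ?thesis
    unfolding rel_b_def fd_apply Th_bilat BB_def structure_series_eq by (auto simp: bilat_x1_x2)
qed

section \<open>Two compatible homomorphisms\<close>

lemma v_nonzero [simp]: "v \<noteq> 0"
  by (simp add: v_def Zero_fract_def eq_fract)

lemma v_minus_inverse_nonzero: "v - inverse v \<noteq> 0"
proof
  assume "v - inverse v = 0"
  then have "v * v = 1" by (simp add: field_simps)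
  then have "[:0, 1:] * [:0, 1 :: rat:] = 1"
    by (simp add: v_def One_fract_def eq_fract)
  then show False by (simp add: one_pCons)
qed

lemma v_neq_inverse [simp]: "v \<noteq> inverse v"
  using v_minus_inverse_nonzero by simp

lemma qint_2: "qint 2 = v + inverse v"
proof -
  have "v powi 2 - v powi (- 2) = (v + inverse v) * (v - inverse v)"
    by (simp add: power_int_minus algebra_simps power2_eq_square)
  then show ?thesis unfolding qint_def by simp
qed

text \<open>\<open>newton_exp\<close> for the series that defines $\Theta$.\<close>

lemma newton_dTheta_exp:
  assumes hom: "free_hom g"
    and comm: "\<And>m n. m \<ge> 1 \<Longrightarrow> n \<ge> 1 \<Longrightarrow> g (dH i m) * g (dH i n) = g (dH i n) * g (dH i m)"
  shows "scalars.newton (free_hom.s g) (\<lambda>n. free_hom.s g (v - inverse v) * g (dH i n))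
    (\<lambda>n. g (fps_nth (dTheta_exp i) n))"
proof -
  interpret free_hom g by (rule hom)
  let ?X = "Abs_fps (\<lambda>m. if m = 0 then 0 else scal (v - inverse v) * dH i m)"
  have "newton (\<lambda>n. g (fps_nth ?X n)) (\<lambda>n. g (fps_nth (dTheta_exp i) n))"
    unfolding dTheta_exp_def
  proof (rule newton_exp)
    fix m n
    have "s a * g (dH i m) * (s a * g (dH i n)) = s a * g (dH i n) * (s a * g (dH i m))"
      if "m \<ge> 1" "n \<ge> 1" for a
      by (simp only: mult.assoc U_left_comm[OF f_U, of "dH i _"] comm[OF that])
    then show "g (fps_nth ?X m) * g (fps_nth ?X n) = g (fps_nth ?X n) * g (fps_nth ?X m)"
      by (simp add: f_mult f_scal)
  qed simp
  moreover have "(\<Sum>m = 1..n. s (of_nat m) * (g (fps_nth ?X m) * T m)) =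
      (\<Sum>m = 1..n. s (of_nat m) * (s (v - inverse v) * g (dH i m) * T m))" for n T
    by (rule sum.cong) (auto simp: f_mult f_scal)
  ultimately show ?thesis by (simp add: newton_def)
qed

text \<open>The common situation for both directions of the theorem: a ring that contains compatible images
  of both free algebras. Centrality of $K$ and $C$ is required with respect to both images, as neither of
  them need contain the other.\<close>

locale compatible_homs = F: free_hom f + G: free_hom g
  for f :: "'i gf_gen free \<Rightarrow> 'b::ring" and g :: "'i dr_gen free \<Rightarrow> 'b" +
  assumes scal_eq: "g (scal a) = f (scal a)"
    and K_eq: "g (dK i) = f (gK i)" and Kinv_eq: "g (dKinv i) = f (gKinv i)"
    and C_eq: "g dC = f gC" and Cinv_eq: "g dCinv = f gCinv"
    and B_eq: "g (dB i l) = f (gB i l)"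
    and Theta_eq: "k \<ge> 1 \<Longrightarrow> g (dTheta i (int k)) = f (gTheta i k)"
    and K_comm: "f (gK i) * f x = f x * f (gK i)" "f (gK i) * g y = g y * f (gK i)"
    and C_comm: "f gC * f x = f x * f gC" "f gC * g y = g y * f gC"
    and K_inverse: "f (gK i) * f (gKinv i) = f 1"
    and C_inverse: "f gC * f gCinv = f 1"
begin

abbreviation s :: "qv \<Rightarrow> 'b" where "s \<equiv> F.s"

text \<open>Names for the images of the generators. Being constants, they allow the rewrite rules below
  to sort products into the order scalars, $K$, $C$, and then the rest without looping.\<close>

definition K where "K i = f (gK i)"
definition b where "b i l = f (gB i l)"
definition Cp where "Cp k = f (gCpow k)"
definition th where "th i m = g (dTheta i m)"
definition h where "h i m = g (dH i m)"
definition t where "t i n = f (Theta_coeff i (int n))"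
definition x where "x i n = s (v - inverse v) * h i n"

lemma g_scal: "g (scal a) = s a"
  by (simp add: scal_eq F.f_scal)

lemma g_1: "g 1 = s 1"
  using g_scal[of 1] by simp

lemma g_U [simp, intro]: "g y \<in> F.U"
  by (simp add: F.U_def scal_central flip: g_scal G.f_mult)

lemma U_gens [simp, intro]:
  "K i \<in> F.U" "b i l \<in> F.U" "Cp k \<in> F.U" "th i m \<in> F.U" "h i n \<in> F.U" "t i n \<in> F.U" "x i n \<in> F.U"
  by (auto simp: K_def b_def Cp_def th_def h_def t_def x_def intro: F.U_mult)

lemma U_assoc: "z \<in> F.U \<Longrightarrow> s 1 * (z * y) = z * y"
  by (metis F.U_one(1) mult.assoc)

lemma scalar_out:
  "K i * (s a * y) = s a * (K i * y)" "b i l * (s a * y) = s a * (b i l * y)"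
  "Cp k * (s a * y) = s a * (Cp k * y)" "th i m * (s a * y) = s a * (th i m * y)"
  "h i n * (s a * y) = s a * (h i n * y)"
  "K i * s a = s a * K i" "b i l * s a = s a * b i l" "Cp k * s a = s a * Cp k"
  "th i m * s a = s a * th i m" "h i n * s a = s a * h i n"
  "s a * (s c * y) = s (a * c) * y" "s a * s c = s (a * c)"
  by ((rule F.U_left_comm F.U_comm, rule U_gens)+) (simp_all add: F.s_mult mult.assoc)

lemma K_out:
  "b i l * K j = K j * b i l" "b i l * (K j * y) = K j * (b i l * y)"
  "th i m * K j = K j * th i m" "th i m * (K j * y) = K j * (th i m * y)"
  "Cp k * K j = K j * Cp k" "Cp k * (K j * y) = K j * (Cp k * y)"
  using K_comm by (simp_all add: K_def b_def th_def Cp_def flip: mult.assoc)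

text \<open>Centrality is only imposed on $C$; it passes to the inverse because
  $C^{-1} y = C^{-1} y C C^{-1} = C C^{-1} y C^{-1} = y C^{-1}$.\<close>

lemma Cinv_comm: "f gCinv * f p = f p * f gCinv" "f gCinv * g q = g q * f gCinv"
proof -
  have *: "f gCinv * z = z * f gCinv" if z: "z * f gC = f gC * z" "z \<in> F.U" for z
  proof -
    have "f gCinv * z = f gCinv * (z * (f gC * f gCinv))"
      using C_inverse F.U_one(2)[OF z(2)] by (simp add: F.f_1)
    also have "\<dots> = (f gC * f gCinv) * z * f gCinv"
      using z(1) C_comm(1)[of gCinv] by (metis mult.assoc)
    also have "\<dots> = z * f gCinv"
      using C_inverse F.U_one(1)[OF z(2)] by (simp add: F.f_1)
    finally show ?thesis .
  qed
  show "f gCinv * f p = f p * f gCinv" "f gCinv * g q = g q * f gCinv"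
    by (rule *; simp add: C_comm)+
qed

lemma power_comm:
  assumes "f z * y = y * f z" "y \<in> F.U"
  shows "f (z ^ n) * y = y * f (z ^ n)"
proof (induction n)
  case (Suc n)
  then show ?case using assms(1) by (simp add: F.f_mult) (metis mult.assoc)
qed (use assms(2) in \<open>simp add: F.f_1 F.U_comm\<close>)

lemma Cp_comm: "Cp k * f p = f p * Cp k" "Cp k * g q = g q * Cp k"
  unfolding Cp_def gCpow_def by (auto intro!: power_comm simp: C_comm Cinv_comm)

lemma Cp_out:
  "b i l * Cp k = Cp k * b i l" "b i l * (Cp k * y) = Cp k * (b i l * y)"
  "th i m * Cp k = Cp k * th i m" "th i m * (Cp k * y) = Cp k * (th i m * y)"
  "h i n * Cp k = Cp k * h i n" "h i n * (Cp k * y) = Cp k * (h i n * y)"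
  using Cp_comm by (simp_all add: h_def b_def th_def flip: mult.assoc)

lemma Cp_nat: "f (gC ^ n) = Cp (int n)"
  by (simp add: Cp_def gCpow_def)

lemma power_eq:
  assumes "g y = f z"
  shows "g (y ^ n) = f (z ^ n)"
  by (induction n) (simp_all only: power_0 power_Suc g_1 F.f_1 G.f_mult F.f_mult assms)

lemma g_Cpow: "g (dCpow k) = Cp k" "g (dC ^ n) = Cp (int n)"
  by (simp_all add: Cp_def dCpow_def gCpow_def power_eq C_eq Cinv_eq)

lemma Cp_Suc: "Cp (k + 1) = Cp k * f gC"
proof (cases "k \<ge> 0")
  case True
  then show ?thesis
    by (simp add: Cp_def gCpow_def nat_add_distrib F.f_mult[symmetric] power_Suc2[symmetric] del: power_Suc)
next
  case False
  define n where "n = nat (- k - 1)"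
  have n: "k = - int (Suc n)" using False by (simp add: n_def)
  have "Cp k * f gC = f (gCinv ^ n) * (f gCinv * f gC)"
  proof -
    have "nat (- k) = Suc n" "\<not> k \<ge> 0" using n by simp_all
    then show ?thesis by (simp only: Cp_def gCpow_def if_False F.f_mult power_Suc2 mult.assoc)
  qed
  also have "\<dots> = f (gCinv ^ n)"
    using C_inverse C_comm(1)[of gCinv] F.U_one(2)[OF F.f_U] by (simp add: F.f_1)
  also have "gCinv ^ n = gCpow (k + 1)"
  proof (cases n)
    case 0
    then show ?thesis by (simp add: gCpow_def n)
  next
    case (Suc n')
    then have "nat (- (k + 1)) = n" "\<not> k + 1 \<ge> 0" using n by simp_all
    then show ?thesis by (simp only: gCpow_def if_False)
  qed
  finally show ?thesis by (simp only: Cp_def)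
qed

lemma Cp_add: "Cp (k + int n) = Cp k * Cp (int n)"
proof (induction n)
  case 0
  have "Cp 0 = s 1" by (simp add: Cp_def gCpow_def F.f_1)
  then show ?case using F.U_one(2)[of "Cp k"] by simp
next
  case (Suc n)
  then show ?case
    using Cp_Suc[of "k + int n"] Cp_Suc[of "int n"] by (simp add: algebra_simps)
qed

lemmas hom_simps = F.f_0 F.f_1 F.f_scal F.f_add F.f_diff F.f_minus F.f_mult F.f_sum
  G.f_0 g_1 g_scal G.f_add G.f_diff G.f_minus G.f_mult G.f_sum
  K_def[symmetric] b_def[symmetric] Cp_def[symmetric] th_def[symmetric] h_def[symmetric]
  K_eq B_eq g_Cpow Cp_nat

lemmas normalize = mult.assoc scalar_out K_out Cp_out

lemma Theta_coeff_eq: "f (Theta_coeff i m) = s (v - inverse v) * th i m"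
proof -
  consider "m < 0" | "m = 0" | "m > 0" by linarith
  then show ?thesis
  proof cases
    case 1
    then show ?thesis by (simp add: th_def dTheta_def Theta_coeff_def)
  next
    case 2
    then show ?thesis by (simp add: th_def dTheta_def Theta_coeff_def g_scal F.f_1 F.s_mult[symmetric])
  next
    case 3
    then have "g (dTheta i m) = f (gTheta i (nat m))" using Theta_eq[of "nat m" i] by simp
    with 3 show ?thesis by (simp add: th_def Theta_coeff_def F.f_mult F.f_scal)
  qed
qed

lemma t_0: "t i 0 = s 1"
  by (simp add: t_def F.f_1)

lemma t_eq_exp: "t i n = g (fps_nth (dTheta_exp i) n)"
proof (cases "n = 0")
  case False
  have "t i n = s (v - inverse v) * (s (inverse (v - inverse v)) * g (fps_nth (dTheta_exp i) n))"
    using False by (simp add: t_def Theta_coeff_eq th_def dTheta_def G.f_mult g_scal)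
  then show ?thesis by (simp add: F.U_one scalar_out)
qed (simp add: t_0 dTheta_exp_def g_1)

lemma newton_x_t:
  assumes "\<And>m n. m \<ge> 1 \<Longrightarrow> n \<ge> 1 \<Longrightarrow> h i m * h i n = h i n * h i m"
  shows "F.newton (x i) (t i)"
proof -
  have "G.s = s" by (rule ext) (simp add: G.s_def g_scal)
  then show ?thesis
    using newton_dTheta_exp[OF G.free_hom_axioms, of i] assms
    by (simp add: x_def t_eq_exp h_def F.newton_def G.newton_def)
qed

text \<open>The $\Theta$'s commute exactly when the $H$'s do, since Newton's recursion expresses each
  family polynomially in the other.\<close>

lemma commuting_currents:
  assumes "\<And>i. F.newton (x i) (t i)"
  shows "(\<forall>i j p q r. f (rel_a i j x1 x2 (p, q, r)) = 0) \<longleftrightarrow>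
    (\<forall>i j m n. m \<ge> 1 \<longrightarrow> n \<ge> 1 \<longrightarrow> g (dH i m * dH j n - dH j n * dH i m) = 0)"
proof -
  have xh: "x i m * x j n = x j n * x i m \<longleftrightarrow> g (dH i m * dH j n - dH j n * dH i m) = 0" for i j m n
  proof -
    have "x i m * x j n = x j n * x i m \<longleftrightarrow>
        s ((v - inverse v) * (v - inverse v)) * (h i m * h j n) =
        s ((v - inverse v) * (v - inverse v)) * (h j n * h i m)"
      by (simp add: x_def normalize)
    also have "\<dots> \<longleftrightarrow> h i m * h j n = h j n * h i m"
      by (rule F.s_cancel) (auto intro: F.U_mult)
    finally show ?thesis by (simp add: hom_simps)
  qed
  have "(\<forall>i j p q r. f (rel_a i j x1 x2 (p, q, r)) = 0) \<longleftrightarrow> (\<forall>i j m n. t i m * t j n = t j n * t i m)"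
    (is "?A \<longleftrightarrow> ?T")
  proof
    assume ?A
    then have "f (Theta_coeff i (int m) * Theta_coeff j (int n) - Theta_coeff j (int n) * Theta_coeff i (int m)) = 0" for i j m n
      by (metis coeff_rel_a)
    then show ?T by (simp add: t_def hom_simps)
  next
    assume T: ?T
    show ?A
    proof (intro allI)
      fix i j p q r
      show "f (rel_a i j x1 x2 (p, q, r)) = 0"
      proof (cases "p < 0 \<or> q < 0")
        case False
        then show ?thesis
          using T[rule_format, of i "nat p" j "nat q"] by (simp add: coeff_rel_a t_def hom_simps)
      qed (auto simp: coeff_rel_a)
    qed
  qed
  also have "?T \<longleftrightarrow> (\<forall>i j m n. m \<ge> 1 \<longrightarrow> n \<ge> 1 \<longrightarrow> x i m * x j n = x j n * x i m)" (is "_ \<longleftrightarrow> ?X")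
  proof
    assume T: ?T
    have "t i m * x j n = x j n * t i m" if "n \<ge> 1" for i j m n
      using F.newton_commute_left[OF assms, of j "t i m" n] T that by (simp add: t_0)
    then show ?X
      using F.newton_commute_left[OF assms, of _ "x _ _"] by (simp add: t_0)
  next
    assume X: ?X
    have "x i m * t j n = t j n * x i m" if "m \<ge> 1" for i j m n
      using F.newton_commute_right[OF assms, of j "x i m" n] X that by (simp add: t_0)
    then show ?T
      using F.newton_commute_right[OF assms, of _ "t _ _"] by (simp add: t_0)
  qed
  also have "?X \<longleftrightarrow> (\<forall>i j m n. m \<ge> 1 \<longrightarrow> n \<ge> 1 \<longrightarrow> g (dH i m * dH j n - dH j n * dH i m) = 0)"
    by (simp add: xh)
  finally show ?thesis .
qed

end

section \<open>Matching the relations\<close>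

text \<open>Naming the single relations lets them be compared index by index with the coefficients of the
  relations between generating functions.\<close>

definition dr_rel2_at :: "('i \<Rightarrow> 'i \<Rightarrow> int) \<Rightarrow> 'i \<Rightarrow> 'i \<Rightarrow> nat \<Rightarrow> int \<Rightarrow> 'i dr_gen free" where
  "dr_rel2_at c i j m l = (dH i m * dB j l - dB j l * dH i m) -
      (scal (qint (int m * c i j) / of_nat m) * dB j (l + int m)
       - scal (qint (int m * c i j) / of_nat m) * dB j (l - int m) * dC ^ m)"

definition dr_rel4_at :: "('i \<Rightarrow> 'i \<Rightarrow> int) \<Rightarrow> 'i \<Rightarrow> 'i \<Rightarrow> int \<Rightarrow> int \<Rightarrow> 'i dr_gen free" where
  "dr_rel4_at c i j k l = qcomm (v powi (- c i j)) (dB i k) (dB j (l + 1))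
      - scal (v powi (- c i j)) * qcomm (v powi (c i j)) (dB i (k + 1)) (dB j l)"

definition dr_rel5_at :: "'i \<Rightarrow> int \<Rightarrow> int \<Rightarrow> 'i dr_gen free" where
  "dr_rel5_at i k l = (qcomm (v powi (- 2)) (dB i k) (dB i (l + 1))
       - scal (v powi (- 2)) * qcomm (v powi 2) (dB i (k + 1)) (dB i l)) -
      (scal (v powi (- 2)) * dTheta i (l - k + 1) * dCpow k * dK i
       - scal (v powi (- 4)) * dTheta i (l - k - 1) * dCpow (k + 1) * dK i
       + scal (v powi (- 2)) * dTheta i (k - l + 1) * dCpow l * dK i
       - scal (v powi (- 4)) * dTheta i (k - l - 1) * dCpow (l + 1) * dK i)"

definition dr_rel6_at :: "'i \<Rightarrow> 'i \<Rightarrow> int \<Rightarrow> int \<Rightarrow> int \<Rightarrow> 'i dr_gen free" where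
  "dr_rel6_at i j k1 k2 l = (dS i j k1 k2 l + dS i j k2 k1 l) - (dR i j k1 k2 l + dR i j k2 k1 l)"

lemma v_powi: "v powi (- 2) = inverse (v ^ 2)" "v powi (- 4) = inverse (v ^ 4)" "v powi 2 = v ^ 2"
  by (simp_all add: power_int_minus)

lemma qint_mult: "(v - inverse v) * qint (int m * k) = (v powi k) ^ m - (v powi (- k)) ^ m"
proof -
  have "v powi (int m * k) = (v powi k) ^ m" "v powi (- (int m * k)) = (v powi (- k)) ^ m"
    using power_int_mult[of v k "int m"] power_int_mult[of v "- k" "int m"] by (simp_all add: mult.commute)
  then show ?thesis by (simp add: qint_def)
qed

context compatible_homs
begin

lemma f_free_transfer_coeff: "f (free_transfer_coeff a a' (gB j) k l) = F.transfer_coeff (\<lambda>q. Cp (int q)) a a' (b j) k l"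
  by (simp add: free_transfer_coeff_def F.transfer_coeff_def hom_simps mult.assoc)

text \<open>An instance of \<open>current_commutation\<close> with $a = v^{-c_{ij}}$ and $b = v^{c_{ij}}$: the
  factor $(b^m - a^m)/m$ is $v - v^{-1}$ times the structure constant $[m c_{ij}]/m$.\<close>

lemma Theta_B_relation:
  assumes "F.newton (x i) (t i)"
  shows "(\<forall>n l r. f (rel_b c i j x1 x2 (n, l, r)) = 0) \<longleftrightarrow> (\<forall>m\<ge>1. \<forall>l. g (dr_rel2_at c i j m l) = 0)"
proof -
  let ?a = "v powi (- c i j)" and ?b = "v powi (c i j)"
  let ?W = "F.transfer_coeff (\<lambda>q. Cp (int q)) ?a ?b (b j)"
  have coeff: "f (rel_b c i j x1 x2 (int n, l, 0)) = t i n * b j l - (\<Sum>k\<le>n. ?W k l * t i (n - k))" for n l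
  proof -
    have "(\<Sum>k\<le>n. ?W k l * f (Theta_coeff i (int n - int k))) = (\<Sum>k\<le>n. ?W k l * t i (n - k))"
      by (rule sum.cong) (auto simp: t_def of_nat_diff)
    then show ?thesis
      by (simp add: coeff_rel_b F.f_diff F.f_mult F.f_sum f_free_transfer_coeff b_def t_def)
  qed
  have "(\<forall>n l r. f (rel_b c i j x1 x2 (n, l, r)) = 0) \<longleftrightarrow>
      (\<forall>n l. t i n * b j l = (\<Sum>k\<le>n. ?W k l * t i (n - k)))" (is "?L \<longleftrightarrow> ?R")
  proof
    assume ?L
    then show ?R using coeff by simp
  next
    assume R: ?R
    show ?L
    proof (intro allI)
      fix n l r
      show "f (rel_b c i j x1 x2 (n, l, r)) = 0"
        using coeff[of "nat n" l] R by (cases "r = 0 \<and> n \<ge> 0") (auto simp: coeff_rel_b)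
    qed
  qed
  also have "\<dots> \<longleftrightarrow> (\<forall>m\<ge>1. \<forall>l. s (of_nat m) * (x i m * b j l - b j l * x i m) =
      s (?b ^ m - ?a ^ m) * (b j (l + int m) - Cp (int m) * b j (l - int m)))"
  proof (rule F.current_commutation[OF assms])
    show "Cp (int 0) = s 1" by (simp add: Cp_def gCpow_def F.f_1)
    show "Cp (int (m + n)) = Cp (int m) * Cp (int n)" for m n
      using Cp_add[of "int m" n] by simp
    show "x i n * Cp (int m) = Cp (int m) * x i n" for m n
      by (simp add: x_def normalize)
  qed (auto simp: t_0)
  also have "\<dots> \<longleftrightarrow> (\<forall>m\<ge>1. \<forall>l. g (dr_rel2_at c i j m l) = 0)"
  proof -
    have "s (of_nat m) * (x i m * b j l - b j l * x i m) =
      s (?b ^ m - ?a ^ m) * (b j (l + int m) - Cp (int m) * b j (l - int m)) \<longleftrightarrow> g (dr_rel2_at c i j m l) = 0"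
      if m: "m \<ge> 1" for m l
    proof -
      have eq: "of_nat m * (v - inverse v) * (qint (int m * c i j) / of_nat m) = ?b ^ m - ?a ^ m"
        using m unfolding qint_mult[symmetric] by (simp add: field_simps)
      have "s (of_nat m * (v - inverse v)) * g (dr_rel2_at c i j m l) =
         s (of_nat m) * (x i m * b j l - b j l * x i m) -
         s (?b ^ m - ?a ^ m) * (b j (l + int m) - Cp (int m) * b j (l - int m))"
        unfolding eq[symmetric] dr_rel2_at_def x_def
        by (simp add: hom_simps normalize right_diff_distrib)
      moreover have "s (of_nat m * (v - inverse v)) * g (dr_rel2_at c i j m l) = s (of_nat m * (v - inverse v)) * 0
          \<longleftrightarrow> g (dr_rel2_at c i j m l) = 0"
        using m by (intro F.s_cancel) auto
      ultimately show ?thesis by simp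
    qed
    then show ?thesis by blast
  qed
  finally show ?thesis .
qed

lemma scaled_zero_iff: "a \<noteq> 0 \<Longrightarrow> s a * g y = 0 \<longleftrightarrow> g y = 0"
  using F.s_cancel[of a "g y" 0] by simp

text \<open>Coefficients are taken at exponents shifted by one because every monomial of the relation
  contains an extra $z$ or $w$.\<close>

lemma B_B_relation:
  "f (rel_d c i j x1 x2 (k + 1, l + 1, 0)) = s (v powi (c i j)) * g (dr_rel4_at c i j k l)"
proof -
  have "v powi (c i j) * v powi (- c i j) = 1"
    "v powi (c i j) * (v powi (- c i j) * v powi (c i j)) = v powi (c i j)"
    by (simp_all add: power_int_minus)
  then show ?thesis
    by (simp add: coeff_rel_d dr_rel4_at_def qcomm_def hom_simps normalize right_diff_distrib F.U_one U_assoc)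
qed

lemma B_B_relation_iff:
  "(\<forall>p q r. f (rel_d c i j x1 x2 (p, q, r)) = 0) \<longleftrightarrow> (\<forall>k l. g (dr_rel4_at c i j k l) = 0)"
proof -
  have "f (rel_d c i j x1 x2 (p, q, r)) = 0" if "r = 0 \<longrightarrow> g (dr_rel4_at c i j (p - 1) (q - 1)) = 0" for p q r
    using B_B_relation[of c i j "p - 1" "q - 1"] that by (cases "r = 0") (auto simp: coeff_rel_d)
  moreover have "g (dr_rel4_at c i j k l) = 0" if "f (rel_d c i j x1 x2 (k + 1, l + 1, 0)) = 0" for k l
    using that unfolding B_B_relation by (subst (asm) scaled_zero_iff) simp_all
  ultimately show ?thesis by blast
qed

lemma B_B_same_relation:
  "f (rel_e i x1 x2 (k + 1, l + 1, 0)) = s (v ^ 2) * g (dr_rel5_at i k l)"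
proof -
  define d where "d = v - inverse v"
  have d: "d \<noteq> 0" by (simp add: d_def)
  have e: "v ^ 2 * inverse (v ^ 2) = 1" "v ^ 2 * inverse (v ^ 4) = inverse (v ^ 2)"
    "inverse (v ^ 2) / d * (v ^ 2 * d) = 1" "inverse (v ^ 2) / d * d = inverse (v ^ 2)"
    using d by (simp_all add: field_simps eval_nat_numeral)
  show ?thesis
    by (simp add: coeff_rel_e dr_rel5_at_def qcomm_def hom_simps Theta_coeff_eq d_def[symmetric] normalize
        right_diff_distrib distrib_left v_powi d e F.U_one U_assoc)
qed

lemma B_B_same_relation_iff:
  "(\<forall>p q r. f (rel_e i x1 x2 (p, q, r)) = 0) \<longleftrightarrow> (\<forall>k l. g (dr_rel5_at i k l) = 0)"
proof -
  have "f (rel_e i x1 x2 (p, q, r)) = 0" if "r = 0 \<longrightarrow> g (dr_rel5_at i (p - 1) (q - 1)) = 0" for p q r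
    using B_B_same_relation[of i "p - 1" "q - 1"] that by (cases "r = 0") (auto simp: coeff_rel_e)
  moreover have "g (dr_rel5_at i k l) = 0" if "f (rel_e i x1 x2 (k + 1, l + 1, 0)) = 0" for k l
    using that unfolding B_B_same_relation by (subst (asm) scaled_zero_iff) simp_all
  ultimately show ?thesis by blast
qed

text \<open>The image of \<open>qcomm\<close> under a homomorphism.\<close>

definition qbracket :: "qv \<Rightarrow> 'b \<Rightarrow> 'b \<Rightarrow> 'b" where
  "qbracket a y z = y * z - s a * (z * y)"

lemma f_qcomm: "f (qcomm a y z) = qbracket a (f y) (f z)"
  by (simp add: qcomm_def qbracket_def hom_simps mult.assoc)

lemma g_qcomm: "g (qcomm a y z) = qbracket a (g y) (g z)"
  by (simp add: qcomm_def qbracket_def hom_simps mult.assoc)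

lemma qbracket_scale: "qbracket a (s e * th i m) (b j l) = s e * qbracket a (th i m) (b j l)"
    "qbracket a (b j l) (s e * th i m) = s e * qbracket a (b j l) (th i m)"
  by (simp_all add: qbracket_def normalize right_diff_distrib mult.commute[of _ e])

lemma qbracket_out:
  assumes "y \<in> F.U" "z \<in> F.U"
  shows "qbracket a y z * s e = s e * qbracket a y z" "qbracket a y z * (s e * w) = s e * (qbracket a y z * w)"
proof -
  have "qbracket a y z \<in> F.U" unfolding qbracket_def using assms by (intro F.U_diff F.U_mult F.U_s)
  then show "qbracket a y z * s e = s e * qbracket a y z" "qbracket a y z * (s e * w) = s e * (qbracket a y z * w)"
    by (rule F.U_comm F.U_left_comm)+
qed

lemma Cp_qbracket: "qbracket a (th i m) (b j l) * Cp k = Cp k * qbracket a (th i m) (b j l)"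
   "qbracket a (b j l) (th i m) * Cp k = Cp k * qbracket a (b j l) (th i m)"
  by (simp_all add: qbracket_def left_diff_distrib right_diff_distrib normalize)

text \<open>The summands of $R(k_1, k_2 | l)$ for $k = k_2 - k_1$, indexed by the exponent \<open>n\<close> of $C$.
  In the first sum of $R$ that exponent is $p + 1$, which is why its summand at \<open>n = 0\<close> is set to
  zero; the last term of $R$ is the summand at \<open>n = 0\<close> of the second family.\<close>

definition Serre_term1 where
  "Serre_term1 i j k l n = (if n = 0 then 0 else
     s (v ^ (2 * (n - 1)) * qint 2) * (qbracket (v powi (- 2)) (th i (k - 2 * int n + 1)) (b j (l - 1)) * Cp (int n)))"

definition Serre_term2 where
  "Serre_term2 i j k l n = (if n = 0 then qbracket (v powi (- 2)) (b j l) (th i k) else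
     s (v ^ (2 * n - 1) * qint 2) * (qbracket (v powi (- 2)) (b j l) (th i (k - 2 * int n)) * Cp (int n)))"

lemma g_Sum_any:
  fixes N :: nat
  assumes "\<And>p. p \<ge> N \<Longrightarrow> F p = 0"
  shows "g (Sum_any F) = (\<Sum>p<N. g (F p))"
proof -
  have "Sum_any F = (\<Sum>p\<in>{..<N}. F (id p))"
    by (rule Sum_any_eq_sum) (use assms in auto)
  then show ?thesis by (simp add: G.f_sum)
qed

lemma g_dR:
  assumes N: "N = nat (k2 - k1) + 1"
  shows "g (dR i j k1 k2 l) = - (K i * (Cp k1 *
     ((\<Sum>n<Suc N. Serre_term1 i j (k2 - k1) l n) + (\<Sum>n<Suc N. Serre_term2 i j (k2 - k1) l n))))"
proof -
  let ?F = "\<lambda>p::nat. scal (v ^ (2 * p) * qint 2)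
           * qcomm (v powi (- 2)) (dTheta i (k2 - k1 - 2 * int p - 1)) (dB j (l - 1)) * dC ^ (p + 1)"
  let ?G = "\<lambda>p::nat. if p \<ge> 1 then scal (v ^ (2 * p - 1) * qint 2)
           * qcomm (v powi (- 2)) (dB j l) (dTheta i (k2 - k1 - 2 * int p)) * dC ^ p else 0"
  have neg: "dTheta i (k2 - k1 - 2 * int p - 1) = 0" if "p \<ge> N" for p
  proof -
    have "k2 - k1 - 2 * int p - 1 < 0" using that N by linarith
    then show ?thesis by (simp add: dTheta_def)
  qed
  have neg': "dTheta i (k2 - k1 - 2 * int p) = 0" if "p \<ge> Suc N" for p
  proof -
    have "k2 - k1 - 2 * int p < 0" using that N by linarith
    then show ?thesis by (simp add: dTheta_def)
  qed
  have "g (Sum_any ?F) = (\<Sum>p<N. g (?F p))"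
    by (rule g_Sum_any) (simp add: neg)
  also have "\<dots> = (\<Sum>p<N. Serre_term1 i j (k2 - k1) l (Suc p))"
  proof (rule sum.cong[OF refl])
    fix p
    have idx: "k2 - k1 - 2 * int (Suc p) + 1 = k2 - k1 - 2 * int p - 1" by simp
    show "g (?F p) = Serre_term1 i j (k2 - k1) l (Suc p)"
      unfolding Serre_term1_def idx by (simp add: G.f_mult g_qcomm g_scal g_Cpow th_def b_def B_eq mult.assoc del: power_Suc of_nat_Suc)
  qed
  also have "\<dots> = (\<Sum>n<Suc N. Serre_term1 i j (k2 - k1) l n)"
    by (subst sum.lessThan_Suc_shift) (simp add: Serre_term1_def)
  finally have 1: "g (Sum_any ?F) = (\<Sum>n<Suc N. Serre_term1 i j (k2 - k1) l n)" .
  have "g (Sum_any ?G) = (\<Sum>p<Suc N. g (?G p))"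
    by (rule g_Sum_any) (simp add: neg')
  also have "\<dots> = (\<Sum>p<N. Serre_term2 i j (k2 - k1) l (Suc p))"
    by (subst sum.lessThan_Suc_shift)
       (simp add: Serre_term2_def G.f_mult g_qcomm g_scal g_Cpow th_def b_def B_eq mult.assoc del: power_Suc of_nat_Suc)
  finally have "g (Sum_any ?G) + g (qcomm (v powi (- 2)) (dB j l) (dTheta i (k2 - k1))) =
      (\<Sum>n<Suc N. Serre_term2 i j (k2 - k1) l n)"
    by (subst sum.lessThan_Suc_shift) (simp add: Serre_term2_def g_qcomm th_def b_def B_eq add.commute)
  with 1 show ?thesis
    by (simp only: dR_def G.f_mult G.f_diff G.f_minus K_eq K_def[symmetric] g_Cpow mult.assoc)
       (simp add: algebra_simps)
qed

text \<open>For $n \ge 1$ the coefficient $v^{2n} + v^{2(n-1)}$ of $x^n$ in $(1 + x)/(1 - v^2 x)$ equals $v^{2n-1} [2]$, the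
  coefficient in $R$. The factor $(v - v^{-1})^{-1}$ cancels against the normalization of
  $\boldsymbol\Theta$.\<close>

lemma f_rhs_f:
  assumes N: "N = nat (k2 - k1) + 1"
  shows "f (rhs_f i j x1 x2 x3 (k1, k2, l)) = - (K i * (Cp k1 *
     ((\<Sum>n<Suc N. Serre_term1 i j (k2 - k1) l n) + (\<Sum>n<Suc N. Serre_term2 i j (k2 - k1) l n))))"
proof -
  define d where "d = v - inverse v"
  have d: "inverse d * d = 1" by (simp add: d_def)
  let ?X = "\<lambda>n. qbracket (v powi (- 2)) (th i (k2 - k1 - 2 * int n + 1)) (b j (l - 1))"
  let ?Y = "\<lambda>n. qbracket (v powi (- 2)) (b j l) (th i (k2 - k1 - 2 * int n))"
  have pw: "v ^ (2 * n) + (if n = 0 then 0 else v ^ (2 * (n - 1))) = (if n = 0 then 1 else v ^ (2 * n - 1) * qint 2)" for n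
    by (cases n) (simp_all add: qint_2 algebra_simps power_add)
  have t1: "K i * s (inverse d) * Cp (k1 + int n) *
        ((if n = 0 then 0 else s d * ?X n * s (qint 2) * s (v ^ (2 * (n - 1)))) +
         s d * ?Y n * s (v ^ (2 * n) + (if n = 0 then 0 else v ^ (2 * (n - 1))))) =
      K i * (Cp k1 * (Serre_term1 i j (k2 - k1) l n + Serre_term2 i j (k2 - k1) l n))" for n
  proof (cases "n = 0")
    case True
    have "inverse d * (d * a) = a" for a using d by (metis mult.assoc mult_1)
    then show ?thesis using True d
      by (simp add: Serre_term1_def Serre_term2_def normalize qbracket_out U_assoc)
  next
    case False
    have dd: "d * (inverse d * a) = a" for a using d by (metis mult.assoc mult.commute mult_1)
    show ?thesis using False unfolding pw
      by (simp add: Cp_add Serre_term1_def Serre_term2_def normalize distrib_left qbracket_out Cp_qbracket dd ac_simps)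
  qed
  have "f (rhs_f i j x1 x2 x3 (k1, k2, l)) = - (\<Sum>n<Suc N. K i * s (inverse d) * Cp (k1 + int n) *
        ((if n = 0 then 0 else s d * ?X n * s (qint 2) * s (v ^ (2 * (n - 1)))) +
         s d * ?Y n * s (v ^ (2 * n) + (if n = 0 then 0 else v ^ (2 * (n - 1))))))"
  proof -
    have N': "nat (k2 - k1) + 2 = Suc N" by (simp add: N)
    show ?thesis
      unfolding coeff_rhs_f N' F.f_minus F.f_sum
      by (intro arg_cong[of _ _ uminus] sum.cong refl)
         (simp add: F.f_mult F.f_add f_qcomm F.f_scal Theta_coeff_eq qbracket_scale K_def[symmetric] Cp_def[symmetric] b_def[symmetric]
           d_def[symmetric] F.s_add power_mult flip: scal_power)
  qed
  then show ?thesis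
    unfolding t1 by (simp only: sum_distrib_left[symmetric] sum.distrib)
qed

lemma Serre_relation: "f (rel_f i j x1 x2 x3 (k1, k2, l)) = g (dr_rel6_at i j k1 k2 l)"
proof -
  have sw: "lhs_f i j x2 x1 x3 (k1, k2, l) = lhs_f i j x1 x2 x3 (k2, k1, l)"
    "rhs_f i j x2 x1 x3 (k1, k2, l) = rhs_f i j x1 x2 x3 (k2, k1, l)"
    using lhs_f_swap12[of i j x1 x2 x3] rhs_f_swap12[of i j x1 x2 x3] by simp_all
  have L: "f (lhs_f i j x1 x2 x3 (p, q, r)) = g (dS i j p q r)" for p q r
    by (simp add: coeff_lhs_f dS_def hom_simps)
  have R: "f (rhs_f i j x1 x2 x3 (p, q, r)) = g (dR i j p q r)" for p q r
    by (simp only: f_rhs_f[OF refl] g_dR[OF refl])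
  show ?thesis
    by (simp add: rel_f_def fd_apply sw dr_rel6_at_def F.f_add F.f_diff G.f_add G.f_diff L R)
qed

lemma Serre_relation_iff:
  "(\<forall>e. f (rel_f i j x1 x2 x3 e) = 0) \<longleftrightarrow> (\<forall>k1 k2 l. g (dr_rel6_at i j k1 k2 l) = 0)"
  by (simp add: Serre_relation split_paired_All)

text \<open>Centrality and invertibility of $K$ and $C$ belong to the hypotheses of the locale; the
  remaining families of relations correspond one to one.\<close>

lemma relations_iff:
  assumes nt: "\<And>i. F.newton (x i) (t i)"
  shows "(\<forall>r\<in>gf_rels c. f r = 0) \<longleftrightarrow> (\<forall>r\<in>dr_rels c. g r = 0)"
proof -
  have "(\<forall>r\<in>gf_rels c. f r = 0) \<longleftrightarrow>
      (\<forall>i j p q r. f (rel_a i j x1 x2 (p, q, r)) = 0) \<and>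
      (\<forall>i j n l r. f (rel_b c i j x1 x2 (n, l, r)) = 0) \<and>
      (\<forall>i j p q r. c i j = 0 \<longrightarrow> f (rel_c i j x1 x2 (p, q, r)) = 0) \<and>
      (\<forall>i j. i \<noteq> j \<longrightarrow> (\<forall>p q r. f (rel_d c i j x1 x2 (p, q, r)) = 0)) \<and>
      (\<forall>i. \<forall>p q r. f (rel_e i x1 x2 (p, q, r)) = 0) \<and>
      (\<forall>i j. c i j = - 1 \<longrightarrow> (\<forall>e. f (rel_f i j x1 x2 x3 e) = 0))"
  proof -
    have "f (gK i * y - y * gK i) = 0" "f (gC * y - y * gC) = 0" for i y
      by (simp_all add: F.f_diff F.f_mult K_comm C_comm)
    moreover have "f (gK i * gKinv i - 1) = 0" "f (gC * gCinv - 1) = 0" for i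
      by (simp_all add: F.f_diff F.f_mult K_inverse C_inverse)
    ultimately have K_C: "\<forall>r\<in>{gK i * gen g - gen g * gK i | i g. True}. f r = 0"
      "\<forall>r\<in>{gC * gen g - gen g * gC | g. True}. f r = 0"
      "\<forall>r\<in>{gK i * gKinv i - 1 | i. True}. f r = 0" "\<forall>r\<in>{gC * gCinv - 1}. f r = 0"
      by blast+
    have E: "(\<forall>r\<in>{rel_a i j x1 x2 e | i j e. True}. f r = 0) \<longleftrightarrow> (\<forall>i j e. f (rel_a i j x1 x2 e) = 0)"
      "(\<forall>r\<in>{rel_b c i j x1 x2 e | i j e. True}. f r = 0) \<longleftrightarrow> (\<forall>i j e. f (rel_b c i j x1 x2 e) = 0)"
      "(\<forall>r\<in>{rel_c i j x1 x2 e | i j e. c i j = 0}. f r = 0) \<longleftrightarrow>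
        (\<forall>i j e. c i j = 0 \<longrightarrow> f (rel_c i j x1 x2 e) = 0)"
      "(\<forall>r\<in>{rel_d c i j x1 x2 e | i j e. i \<noteq> j}. f r = 0) \<longleftrightarrow>
        (\<forall>i j. i \<noteq> j \<longrightarrow> (\<forall>e. f (rel_d c i j x1 x2 e) = 0))"
      "(\<forall>r\<in>{rel_e i x1 x2 e | i e. True}. f r = 0) \<longleftrightarrow> (\<forall>i e. f (rel_e i x1 x2 e) = 0)"
      "(\<forall>r\<in>{rel_f i j x1 x2 x3 e | i j e. c i j = - 1}. f r = 0) \<longleftrightarrow>
        (\<forall>i j. c i j = - 1 \<longrightarrow> (\<forall>e. f (rel_f i j x1 x2 x3 e) = 0))"
      by blast+
    show ?thesis
      unfolding gf_rels_def ball_Un E K_C[THEN eqTrueI] split_paired_All by (simp only: simp_thms conj_assoc)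
  qed
  moreover have "(\<forall>r\<in>dr_rels c. g r = 0) \<longleftrightarrow>
      (\<forall>i j m n. m \<ge> 1 \<longrightarrow> n \<ge> 1 \<longrightarrow> g (dH i m * dH j n - dH j n * dH i m) = 0) \<and>
      (\<forall>i j. \<forall>m\<ge>1. \<forall>l. g (dr_rel2_at c i j m l) = 0) \<and>
      (\<forall>i j k l. c i j = 0 \<longrightarrow> g (dB i k * dB j l - dB j l * dB i k) = 0) \<and>
      (\<forall>i j. i \<noteq> j \<longrightarrow> (\<forall>k l. g (dr_rel4_at c i j k l) = 0)) \<and>
      (\<forall>i k l. g (dr_rel5_at i k l) = 0) \<and>
      (\<forall>i j. c i j = - 1 \<longrightarrow> (\<forall>k1 k2 l. g (dr_rel6_at i j k1 k2 l) = 0))"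
  proof -
    have "g (dK i * y - y * dK i) = 0" "g (dC * y - y * dC) = 0" for i y
      by (simp_all add: G.f_diff G.f_mult K_eq C_eq K_comm C_comm)
    moreover have "g (dK i * dKinv i - 1) = 0" "g (dC * dCinv - 1) = 0" for i
      by (simp_all add: G.f_diff G.f_mult K_eq C_eq Kinv_eq Cinv_eq K_inverse C_inverse g_1 F.f_1)
    ultimately have "(\<forall>r\<in>dr_rel1. g r = 0) \<longleftrightarrow>
        (\<forall>i j m n. m \<ge> 1 \<longrightarrow> n \<ge> 1 \<longrightarrow> g (dH i m * dH j n - dH j n * dH i m) = 0)"
      unfolding dr_rel1_def ball_Un by blast
    moreover have "(\<forall>r\<in>dr_rel2 c. g r = 0) \<longleftrightarrow> (\<forall>i j. \<forall>m\<ge>1. \<forall>l. g (dr_rel2_at c i j m l) = 0)"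
      unfolding dr_rel2_def dr_rel2_at_def by blast
    moreover have "(\<forall>r\<in>dr_rel3 c. g r = 0) \<longleftrightarrow>
        (\<forall>i j k l. c i j = 0 \<longrightarrow> g (dB i k * dB j l - dB j l * dB i k) = 0)"
      unfolding dr_rel3_def by blast
    moreover have "(\<forall>r\<in>dr_rel4 c. g r = 0) \<longleftrightarrow> (\<forall>i j. i \<noteq> j \<longrightarrow> (\<forall>k l. g (dr_rel4_at c i j k l) = 0))"
      unfolding dr_rel4_def dr_rel4_at_def by blast
    moreover have "(\<forall>r\<in>dr_rel5. g r = 0) \<longleftrightarrow> (\<forall>i k l. g (dr_rel5_at i k l) = 0)"
      unfolding dr_rel5_def dr_rel5_at_def by blast
    moreover have "(\<forall>r\<in>dr_rel6 c. g r = 0) \<longleftrightarrow>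
        (\<forall>i j. c i j = - 1 \<longrightarrow> (\<forall>k1 k2 l. g (dr_rel6_at i j k1 k2 l) = 0))"
      unfolding dr_rel6_def dr_rel6_at_def by blast
    ultimately show ?thesis unfolding dr_rels_def ball_Un by simp
  qed
  moreover have "(\<forall>i j p q r. c i j = 0 \<longrightarrow> f (rel_c i j x1 x2 (p, q, r)) = 0) \<longleftrightarrow>
      (\<forall>i j k l. c i j = 0 \<longrightarrow> g (dB i k * dB j l - dB j l * dB i k) = 0)"
    by (auto simp: coeff_rel_c hom_simps)
  ultimately show ?thesis
    by (simp only: commuting_currents[OF nt] Theta_B_relation[OF nt] B_B_relation_iff
        B_B_same_relation_iff Serre_relation_iff)
qed

end

section \<open>The two substitutions\<close>

fun to_dr :: "'i gf_gen \<Rightarrow> 'i dr_gen free" where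
  "to_dr (GfK i) = dK i"
| "to_dr (GfKinv i) = dKinv i"
| "to_dr GfC = dC"
| "to_dr GfCinv = dCinv"
| "to_dr (GfThetaSuc i m) = dTheta i (int (Suc m))"
| "to_dr (GfB i l) = dB i l"

text \<open>Newton's recursion solved for its last term: these are the coefficients of
  $\log \boldsymbol\Theta_i$, up to the order of the factors, which is immaterial once the $\Theta_{i,m}$ commute.\<close>

fun log_Theta :: "'i \<Rightarrow> nat \<Rightarrow> 'i gf_gen free" where
  "log_Theta i n = Theta_coeff i (int n) -
     (\<Sum>m\<in>{1..<n}. scal (of_nat m / of_nat n) * (log_Theta i m * Theta_coeff i (int (n - m))))"

declare log_Theta.simps [simp del]

definition H_of_Theta :: "'i \<Rightarrow> nat \<Rightarrow> 'i gf_gen free" where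
  "H_of_Theta i n = scal (inverse (v - inverse v)) * log_Theta i n"

fun to_gf :: "'i dr_gen \<Rightarrow> 'i gf_gen free" where
  "to_gf (DrK i) = gK i"
| "to_gf (DrKinv i) = gKinv i"
| "to_gf DrC = gC"
| "to_gf DrCinv = gCinv"
| "to_gf (DrHSuc i m) = H_of_Theta i (Suc m)"
| "to_gf (DrB i l) = gB i l"

lemma newton_log_Theta:
  assumes "free_hom f"
  shows "scalars.newton (free_hom.s f) (\<lambda>n. f (log_Theta i n)) (\<lambda>n. f (Theta_coeff i (int n)))"
proof -
  interpret free_hom f by (rule assms)
  have "s (of_nat n) * f (Theta_coeff i (int n)) =
      (\<Sum>m = 1..n. s (of_nat m) * (f (log_Theta i m) * f (Theta_coeff i (int (n - m)))))" for n
  proof (cases "n = 0")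
    case False
    let ?S = "\<Sum>m\<in>{1..<n}. s (of_nat m) * (f (log_Theta i m) * f (Theta_coeff i (int (n - m))))"
    have "f (log_Theta i n) = f (Theta_coeff i (int n)) -
        (\<Sum>m\<in>{1..<n}. s (of_nat m / of_nat n) * (f (log_Theta i m) * f (Theta_coeff i (int (n - m)))))"
      by (subst log_Theta.simps) (simp only: f_diff f_sum f_mult f_scal)
    then have "s (of_nat n) * f (Theta_coeff i (int n)) = s (of_nat n) * f (log_Theta i n) +
        (\<Sum>m\<in>{1..<n}. s (of_nat n) * (s (of_nat m / of_nat n) * (f (log_Theta i m) * f (Theta_coeff i (int (n - m))))))"
      by (simp add: right_diff_distrib sum_distrib_left[symmetric])
    also have "(\<Sum>m\<in>{1..<n}. s (of_nat n) * (s (of_nat m / of_nat n) * (f (log_Theta i m) * f (Theta_coeff i (int (n - m)))))) = ?S"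
      using False by (intro sum.cong refl) (simp add: mult.assoc[symmetric] s_mult[symmetric])
    also have "s (of_nat n) * f (log_Theta i n) + ?S =
        (\<Sum>m = 1..n. s (of_nat m) * (f (log_Theta i m) * f (Theta_coeff i (int (n - m)))))"
    proof -
      have "{1..n} = insert n {1..<n}" using False by auto
      then show ?thesis using U_one(2)[OF f_U[of "log_Theta i n"]] by (simp add: f_1)
    qed
    finally show ?thesis .
  qed simp
  then show ?thesis by (simp add: newton_def)
qed

lemma free_hom_quo: "free_hom (quo R)"
  by unfold_locales (simp_all add: quo_add quo_mult)

lemma free_hom_quo_subst: "free_hom (\<lambda>p. quo R (subst \<sigma> p))"
  by unfold_locales (simp_all add: quo_add quo_mult subst_add subst_mult)

lemma quo_rel:
  assumes "x - y \<in> R"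
  shows "quo R x = quo R y"
proof -
  interpret free_hom "quo R" by (rule free_hom_quo)
  have "quo R (x - y) = 0" using assms by (simp add: quo_eq_0_iff rideal_rel)
  then show ?thesis by (simp add: f_diff)
qed

lemma quo_subst_subst:
  assumes "\<And>g. quo R (subst \<sigma> (\<tau> g)) = quo R (gen g)"
  shows "quo R (subst \<sigma> (subst \<tau> p)) = quo R p"
  by (induction p rule: free_alg_induct)
     (simp_all add: assms subst_scal subst_add subst_mult quo_add quo_mult)

lemma subst_1 [simp]: "subst \<sigma> 1 = 1"
  using subst_scal[of \<sigma> 1] by simp

lemma compatible_homs_dr:
  "compatible_homs (\<lambda>p. quo (dr_rels c) (subst to_dr p)) (quo (dr_rels c))"
proof -
  let ?g = "quo (dr_rels c)"
  interpret g: free_hom ?g by (rule free_hom_quo)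
  interpret f: free_hom "\<lambda>p. ?g (subst to_dr p)" by (rule free_hom_quo_subst)
  have K: "?g (dK i) * ?g y = ?g y * ?g (dK i)" for i y
    by (rule g.commute_all, unfold g.f_mult[symmetric], rule quo_rel) (auto simp: dr_rels_def dr_rel1_def)
  have C: "?g dC * ?g y = ?g y * ?g dC" for y
    by (rule g.commute_all, unfold g.f_mult[symmetric], rule quo_rel) (auto simp: dr_rels_def dr_rel1_def)
  have "?g (dK i * dKinv i) = ?g 1" "?g (dC * dCinv) = ?g 1" for i
    by (rule quo_rel, auto simp: dr_rels_def dr_rel1_def)+
  then show ?thesis
    by unfold_locales (simp_all add: K C subst_scal gTheta_def g.f_mult)
qed

lemma newton_dr:
  "scalars.newton (free_hom.s (quo (dr_rels c)))
     (\<lambda>n. free_hom.s (quo (dr_rels c)) (v - inverse v) * quo (dr_rels c) (dH i n))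
     (\<lambda>n. quo (dr_rels c) (fps_nth (dTheta_exp i) n))"
proof (rule newton_dTheta_exp[OF free_hom_quo])
  fix m n :: nat assume "m \<ge> 1" "n \<ge> 1"
  then have "dH i m * dH i n - dH i n * dH i m \<in> dr_rels c"
    unfolding dr_rels_def dr_rel1_def by blast
  then show "quo (dr_rels c) (dH i m) * quo (dr_rels c) (dH i n) =
      quo (dr_rels c) (dH i n) * quo (dr_rels c) (dH i m)"
    unfolding quo_mult[symmetric] by (rule quo_rel)
qed

lemma gf_rels_to_dr:
  assumes "r \<in> gf_rels c"
  shows "quo (dr_rels c) (subst to_dr r) = 0"
proof -
  interpret compatible_homs "\<lambda>p. quo (dr_rels c) (subst to_dr p)" "quo (dr_rels c)"
    by (rule compatible_homs_dr)
  have "G.s = s" by (rule ext) (simp add: G.s_def g_scal)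
  then have "F.newton (x i) (t i)" for i
    using newton_dr[of c i] by (simp add: F.newton_def G.newton_def x_def[abs_def] h_def t_eq_exp)
  moreover have "\<forall>r\<in>dr_rels c. quo (dr_rels c) r = 0"
    by (simp add: quo_eq_0_iff rideal_rel)
  ultimately show ?thesis using relations_iff assms by blast
qed

text \<open>The image of \<open>H_of_Theta\<close> and the generator $H$ solve Newton's recursion for the same
  right-hand side, so they agree.\<close>

lemma to_dr_to_gf: "quo (dr_rels c) (subst to_dr (subst to_gf p)) = quo (dr_rels c) p"
proof (rule quo_subst_subst)
  interpret compatible_homs "\<lambda>p. quo (dr_rels c) (subst to_dr p)" "quo (dr_rels c)"
    by (rule compatible_homs_dr)
  have sG: "G.s = s" by (rule ext) (simp add: G.s_def g_scal)
  fix z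
  show "quo (dr_rels c) (subst to_dr (to_gf z)) = quo (dr_rels c) (gen z)"
  proof (cases z)
    case (DrHSuc i m)
    let ?y = "\<lambda>n. quo (dr_rels c) (subst to_dr (log_Theta i n))"
    have "F.newton ?y (t i)"
      using newton_log_Theta[OF F.free_hom_axioms, of i] by (simp add: F.newton_def t_def)
    moreover have "F.newton (x i) (t i)"
      using newton_dr[of c i] sG by (simp add: F.newton_def G.newton_def x_def[abs_def] h_def t_eq_exp)
    ultimately have "?y (Suc m) = x i (Suc m)"
      by (rule F.newton_unique_left) (auto simp: t_0)
    then have "quo (dr_rels c) (subst to_dr (H_of_Theta i (Suc m))) = h i (Suc m)"
      by (simp add: H_of_Theta_def F.f_mult F.f_scal x_def scalar_out F.U_one)
    then show ?thesis by (simp add: DrHSuc h_def dH_def)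
  qed simp_all
qed

text \<open>The $\Theta$'s commute modulo the relations, hence so do the images of the $H$'s, hence their
  exponential satisfies Newton's recursion. The generators $\Theta$ satisfy it by construction of
  \<open>log_Theta\<close>, and its solution is unique.\<close>

lemma to_gf_currents:
  shows to_gf_Theta: "k \<ge> 1 \<Longrightarrow>
      quo (gf_rels c) (subst to_gf (dTheta i (int k))) = quo (gf_rels c) (gTheta i k)"
    and to_gf_H_comm: "m \<ge> 1 \<Longrightarrow> n \<ge> 1 \<Longrightarrow>
      quo (gf_rels c) (subst to_gf (dH i m)) * quo (gf_rels c) (subst to_gf (dH i n)) =
      quo (gf_rels c) (subst to_gf (dH i n)) * quo (gf_rels c) (subst to_gf (dH i m))"
proof -
  let ?f = "quo (gf_rels c)" and ?g = "\<lambda>p. quo (gf_rels c) (subst to_gf p)"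
  interpret F: free_hom ?f by (rule free_hom_quo)
  interpret G: free_hom ?g by (rule free_hom_quo_subst)
  have sG: "G.s = F.s" by (rule ext) (simp add: G.s_def F.s_def subst_scal)
  define y where "y n = ?f (log_Theta i n)" for n
  define T where "T n = ?f (Theta_coeff i (int n))" for n
  have nt: "F.newton y T"
    using newton_log_Theta[OF F.free_hom_axioms, of i] by (simp add: F.newton_def y_def T_def)
  have T0: "T 0 = F.s 1" by (simp add: T_def F.f_1)
  have U: "y n \<in> F.U" "T n \<in> F.U" for n by (auto simp: y_def T_def)
  have TT: "T m * T n = T n * T m" for m n
  proof -
    have "rel_a i i x1 x2 (int m, int n, 0) \<in> gf_rels c"
      unfolding gf_rels_def by blast
    then show ?thesis
      unfolding T_def quo_mult[symmetric] by (intro quo_rel) (simp add: coeff_rel_a)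
  qed
  have Ty: "T m * y n = y n * T m" if "n \<ge> 1" for m n
    using that by (intro F.newton_commute_left[OF nt T0]) (auto simp: U TT)
  have yy: "y m * y n = y n * y m" if "m \<ge> 1" "n \<ge> 1" for m n
    using that by (intro F.newton_commute_left[OF nt T0]) (auto simp: U Ty)
  have H_of_Theta: "?g (dH i n) = F.s (inverse (v - inverse v)) * y n" if "n \<ge> 1" for n
    using that by (simp add: dH_def H_of_Theta_def F.f_mult F.f_scal y_def)
  have comm: "?g (dH i m) * ?g (dH i n) = ?g (dH i n) * ?g (dH i m)" if "m \<ge> 1" "n \<ge> 1" for m n
    unfolding H_of_Theta[OF that(1)] H_of_Theta[OF that(2)] mult.assoc F.U_left_comm[OF U(1)] yy[OF that] ..
  then show "m \<ge> 1 \<Longrightarrow> n \<ge> 1 \<Longrightarrow> ?g (dH i m) * ?g (dH i n) = ?g (dH i n) * ?g (dH i m)" .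
  have "G.newton (\<lambda>n. G.s (v - inverse v) * ?g (dH i n)) (\<lambda>n. ?g (fps_nth (dTheta_exp i) n))"
    by (rule newton_dTheta_exp[OF G.free_hom_axioms]) (rule comm)
  moreover have "(\<Sum>m = 1..n. F.s (of_nat m) * (F.s (v - inverse v) * ?g (dH i m) * Z m)) =
      (\<Sum>m = 1..n. F.s (of_nat m) * (y m * Z m))" for n Z
  proof (rule sum.cong[OF refl])
    fix m assume "m \<in> {1..n}"
    then have "F.s (v - inverse v) * ?g (dH i m) = y m"
      by (simp add: H_of_Theta mult.assoc[symmetric] F.s_mult[symmetric] F.U_one U)
    then show "F.s (of_nat m) * (F.s (v - inverse v) * ?g (dH i m) * Z m) = F.s (of_nat m) * (y m * Z m)"
      by simp
  qed
  ultimately have "F.newton y (\<lambda>n. ?g (fps_nth (dTheta_exp i) n))"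
    by (simp add: F.newton_def G.newton_def sG)
  then have "?g (fps_nth (dTheta_exp i) n) = T n" for n
  proof (rule F.newton_unique_right[OF _ nt])
    show "?g (fps_nth (dTheta_exp i) 0) = T 0"
      by (simp add: dTheta_exp_def T0 F.f_1)
  qed (auto simp: U)
  then show "?g (dTheta i (int k)) = ?f (gTheta i k)" if "k \<ge> 1"
    using that by (simp add: dTheta_def subst_mult subst_scal F.f_mult F.f_scal T_def Theta_coeff_def
        mult.assoc[symmetric] F.s_mult[symmetric] F.U_one)
qed

lemma compatible_homs_gf:
  "compatible_homs (quo (gf_rels c)) (\<lambda>p. quo (gf_rels c) (subst to_gf p))"
proof -
  let ?f = "quo (gf_rels c)"
  interpret f: free_hom ?f by (rule free_hom_quo)
  interpret g: free_hom "\<lambda>p. ?f (subst to_gf p)" by (rule free_hom_quo_subst)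
  have K: "?f (gK i) * ?f y = ?f y * ?f (gK i)" for i y
    by (rule f.commute_all, unfold f.f_mult[symmetric], rule quo_rel) (auto simp: gf_rels_def)
  have C: "?f gC * ?f y = ?f y * ?f gC" for y
    by (rule f.commute_all, unfold f.f_mult[symmetric], rule quo_rel) (auto simp: gf_rels_def)
  have "?f (gK i * gKinv i) = ?f 1" "?f (gC * gCinv) = ?f 1" for i
    by (rule quo_rel, force simp: gf_rels_def)+
  then show ?thesis
    by unfold_locales (simp_all add: K C subst_scal to_gf_Theta f.f_mult)
qed

lemma dr_rels_to_gf:
  assumes "r \<in> dr_rels c"
  shows "quo (gf_rels c) (subst to_gf r) = 0"
proof -
  interpret compatible_homs "quo (gf_rels c)" "\<lambda>p. quo (gf_rels c) (subst to_gf p)"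
    by (rule compatible_homs_gf)
  have "F.newton (x i) (t i)" for i
    by (rule newton_x_t) (simp add: h_def to_gf_H_comm)
  moreover have "\<forall>r\<in>gf_rels c. quo (gf_rels c) r = 0"
    by (simp add: quo_eq_0_iff rideal_rel)
  ultimately show ?thesis using relations_iff assms by blast
qed

lemma to_gf_to_dr: "quo (gf_rels c) (subst to_gf (subst to_dr p)) = quo (gf_rels c) p"
proof (rule quo_subst_subst)
  fix z
  show "quo (gf_rels c) (subst to_gf (to_dr z)) = quo (gf_rels c) (gen z)"
  proof (cases z)
    case (GfThetaSuc i m)
    then show ?thesis using to_gf_Theta[where k = "Suc m"] by (simp add: gTheta_def)
  qed simp_all
qed

section \<open>The isomorphism\<close>

lemma cls_eq_iff: "cls R x = cls R y \<longleftrightarrow> quo R x = quo R y"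
proof -
  have "cls R x = cls R y \<longleftrightarrow> x - y \<in> rideal R"
  proof
    assume "cls R x = cls R y"
    moreover have "x \<in> cls R x"
      unfolding cls_def a_r_coset_def' using rideal_0[of R] by force
    ultimately obtain h where "h \<in> rideal R" "x = h + y"
      unfolding cls_def a_r_coset_def' by auto
    then show "x - y \<in> rideal R" by simp
  next
    have sub: "cls R x \<subseteq> cls R y" if "x - y \<in> rideal R" for x y
    proof
      fix z assume "z \<in> cls R x"
      then obtain h where "h \<in> rideal R" "z = h + x"
        unfolding cls_def a_r_coset_def' by auto
      then have "h + (x - y) \<in> rideal R" "z = (h + (x - y)) + y"
        using that rideal_add by auto
      then show "z \<in> cls R y" unfolding cls_def a_r_coset_def' by force
    qed
    assume "x - y \<in> rideal R"
    then show "cls R x = cls R y"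
      using sub[of x y] sub[of y x] rideal_uminus[of "x - y" R] by auto
  qed
  also have "\<dots> \<longleftrightarrow> quo R x = quo R y"
  proof -
    interpret free_hom "quo R" by (rule free_hom_quo)
    show ?thesis unfolding quo_eq_0_iff[symmetric] by (simp add: f_diff)
  qed
  finally show ?thesis .
qed

lemma carrier_presented: "carrier (presented R) = range (cls R)"
  by (auto simp: presented_def FactRing_def A_RCOSETS_def' cls_def)

lemma cls_ring_hom: "cls R \<in> ring_hom free_alg (presented R)"
  using ideal.rcos_ring_hom[OF ideal_rideal[of R]] by (simp add: presented_def cls_def[abs_def])

lemma cls_hom_simps:
  "cls R x \<otimes>\<^bsub>presented R\<^esub> cls R y = cls R (x * y)"
  "cls R x \<oplus>\<^bsub>presented R\<^esub> cls R y = cls R (x + y)"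
  "\<one>\<^bsub>presented R\<^esub> = cls R 1"
  using ring_hom_mult[OF cls_ring_hom, of x y R] ring_hom_add[OF cls_ring_hom, of x y R]
    ring_hom_one[OF cls_ring_hom, of R] by simp_all

text \<open>Respecting the relations makes both substitutions well defined on cosets; that they are
  inverse to each other there gives bijectivity.\<close>

lemma presented_iso:
  assumes \<sigma>: "\<And>r. r \<in> R \<Longrightarrow> quo R' (subst \<sigma> r) = 0"
    and \<tau>: "\<And>r. r \<in> R' \<Longrightarrow> quo R (subst \<tau> r) = 0"
    and \<tau>\<sigma>: "\<And>p. quo R (subst \<tau> (subst \<sigma> p)) = quo R p"
    and \<sigma>\<tau>: "\<And>p. quo R' (subst \<sigma> (subst \<tau> p)) = quo R' p"
  shows "\<exists>\<phi>\<in>ring_iso (presented R) (presented R'). \<forall>p. \<phi> (cls R p) = cls R' (subst \<sigma> p)"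
proof -
  have well_defined: "quo R' (subst \<sigma> p) = quo R' (subst \<sigma> q)"
    if eq: "quo R p = quo R q" and rel: "\<And>r. r \<in> R \<Longrightarrow> quo R' (subst \<sigma> r) = 0" for R R' p q \<sigma>
  proof -
    interpret Q: free_hom "quo R" by (rule free_hom_quo)
    interpret free_hom "\<lambda>p. quo R' (subst \<sigma> p)" by (rule free_hom_quo_subst)
    have "p - q \<in> rideal R" using eq by (simp add: Q.f_diff flip: quo_eq_0_iff)
    then have "quo R' (subst \<sigma> (p - q)) = 0" using vanishes_on_rideal rel by blast
    then show ?thesis by (simp add: f_diff)
  qed
  have iff: "quo R' (subst \<sigma> p) = quo R' (subst \<sigma> q) \<longleftrightarrow> quo R p = quo R q" for p q
    using well_defined[of R p q R' \<sigma>] well_defined[of R' "subst \<sigma> p" "subst \<sigma> q" R \<tau>] \<sigma> \<tau> \<tau>\<sigma> by auto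
  define \<phi> where "\<phi> X = cls R' (subst \<sigma> (SOME p. X = cls R p))" for X
  have \<phi>: "\<phi> (cls R p) = cls R' (subst \<sigma> p)" for p
  proof -
    have "cls R p = cls R (SOME q. cls R p = cls R q)" by (rule someI) (rule refl)
    then show ?thesis unfolding \<phi>_def by (metis cls_eq_iff iff)
  qed
  have "\<phi> \<in> ring_iso (presented R) (presented R')"
    unfolding ring_iso_def
  proof (intro CollectI conjI)
    show "\<phi> \<in> ring_hom (presented R) (presented R')"
      by (rule ring_hom_memI) (auto simp: carrier_presented \<phi> cls_hom_simps subst_add subst_mult)
    have "inj_on \<phi> (range (cls R))"
      by (rule inj_onI, elim rangeE) (simp add: \<phi> cls_eq_iff iff)
    moreover have "\<phi> ` range (cls R) = range (cls R')"
    proof -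
      have "cls R' p \<in> \<phi> ` range (cls R)" for p
        by (rule image_eqI[of _ _ "cls R (subst \<tau> p)"]) (simp_all add: \<phi> cls_eq_iff \<sigma>\<tau>)
      then show ?thesis by (auto simp: \<phi>)
    qed
    ultimately show "bij_betw \<phi> (carrier (presented R)) (carrier (presented R'))"
      by (simp add: bij_betw_def carrier_presented)
  qed
  with \<phi> show ?thesis by blast
qed

theorem theorem5p1:
  fixes c :: "'i \<Rightarrow> 'i \<Rightarrow> int"
  assumes "ADE_cartan c"
  shows "\<exists>\<phi>. \<phi> \<in> ring_iso (presented (gf_rels c)) (presented (dr_rels c)) \<and>
    (\<forall>a. \<phi> (cls (gf_rels c) (scal a)) = cls (dr_rels c) (scal a)) \<and>
    (\<forall>i. \<phi> (cls (gf_rels c) (gK i)) = cls (dr_rels c) (dK i)) \<and>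
    (\<forall>i. \<phi> (cls (gf_rels c) (gKinv i)) = cls (dr_rels c) (dKinv i)) \<and>
    \<phi> (cls (gf_rels c) gC) = cls (dr_rels c) dC \<and>
    \<phi> (cls (gf_rels c) gCinv) = cls (dr_rels c) dCinv \<and>
    (\<forall>i. \<forall>k\<ge>1. \<phi> (cls (gf_rels c) (gTheta i k)) = cls (dr_rels c) (dTheta i (int k))) \<and>
    (\<forall>i l. \<phi> (cls (gf_rels c) (gB i l)) = cls (dr_rels c) (dB i l))"
proof -
  obtain \<phi> where "\<phi> \<in> ring_iso (presented (gf_rels c)) (presented (dr_rels c))"
    and "\<And>p. \<phi> (cls (gf_rels c) p) = cls (dr_rels c) (subst to_dr p)"
    using presented_iso[OF gf_rels_to_dr dr_rels_to_gf to_gf_to_dr to_dr_to_gf] by blast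
  then show ?thesis
    by (intro exI[of _ \<phi>]) (simp add: subst_scal gTheta_def)
qed

end
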